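(* There is an absolute constant $C>0$ such that the following holds. For all $n, s, k \in \mathbb{N}$, all $\varepsilon > 0$ and all distributions $\mathcal{D}_0, \mathcal{D}_1$ on $\{0,1\}^n$, there exist $s' \in \mathbb{N}$ and distributions $\widetilde{\mathcal{D}}_0, \widetilde{\mathcal{D}}_1$ on $\{0,1\}^n$ such that $d_{s'}(\mathcal{D}_b, \widetilde{\mathcal{D}}_b) \le \varepsilon$ for each $b \in \{0,1\}$, \[ d_{s'}(\mathcal{D}_0^{\otimes k}, \mathcal{D}_1^{\otimes k}) - k\varepsilon \le d_{\mathrm{TV}}(\widetilde{\mathcal{D}}_0^{\otimes k}, \widetilde{\mathcal{D}}_1^{\otimes k}) \le d_{s'}(\mathcal{D}_0^{\otimes k}, \mathcal{D}_1^{\otimes k}) + k\varepsilon, \] and $s \le s' \le k^{1/\varepsilon^2}\bigl(s + (k/\varepsilon)^{C}\bigr)$. Moreover, one can additionally require $\widetilde{\mathcal{D}}_0 = \mathcal{D}_0$, with $s \le s' \le k^{1/\varepsilon^4}\bigl(s + (k/\varepsilon)^{C}\bigr)$ instead.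
   Context: For distributions $P, Q$ on $\{0,1\}^m$ and $t \in \mathbb{N}$, $d_t(P,Q)$ denotes the largest distinguishing advantage $\bigl|\mathbb{E}_{z\sim P}[A(z)] - \mathbb{E}_{z \sim Q}[A(z)]\bigr|$ achievable by a Boolean circuit $A : \{0,1\}^m \to \{0,1\}$ of size at most $t$; $d_{\mathrm{TV}}$ is total variation distance; $\mathcal{D}^{\otimes k}$ is the distribution of $k$ independent samples from $\mathcal{D}$.
   Formalization: The formal theorem assumes k ≥ 2: for k = 0 the size bound forces s' = 0, which fails when s > 0, and for k = 1 the bound s' ≤ s + (1/ε)^C is false for every C, by a counting argument with a hard function h. *)

theory Defs
  imports "HOL-Probability.Probability"
begin

text \<open>
  Boolean circuits over the basis AND, OR (fan-in two) and NOT, as straight-line programs.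
  A gate reads input bits, Boolean constants, or the values of earlier gates (with unbounded
  fan-out). The size of a circuit is its number of gates, negations included; input bits and
  constants are free.
\<close>

datatype wire = Input nat | Const bool | Gate nat

datatype gate = And wire wire | Or wire wire | Not wire

datatype circuit = Circuit (gates: "gate list") (out_wire: wire)

definition circuit_size :: "circuit \<Rightarrow> nat" where
  "circuit_size c = length (gates c)"

text \<open>\<open>wire_ok m j w\<close>: there are \<open>m\<close> input bits, and gates \<open>0, \<dots>, j - 1\<close> may be read.\<close>

fun wire_ok :: "nat \<Rightarrow> nat \<Rightarrow> wire \<Rightarrow> bool" where
  "wire_ok m j (Input i) = (i < m)"
| "wire_ok m j (Const b) = True"
| "wire_ok m j (Gate i) = (i < j)"

fun gate_ok :: "nat \<Rightarrow> nat \<Rightarrow> gate \<Rightarrow> bool" where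
  "gate_ok m j (And u v) = (wire_ok m j u \<and> wire_ok m j v)"
| "gate_ok m j (Or u v) = (wire_ok m j u \<and> wire_ok m j v)"
| "gate_ok m j (Not u) = wire_ok m j u"

definition wf_circuit :: "nat \<Rightarrow> circuit \<Rightarrow> bool" where
  "wf_circuit m c \<longleftrightarrow>
     (\<forall>j < length (gates c). gate_ok m j (gates c ! j)) \<and> wire_ok m (length (gates c)) (out_wire c)"

fun wire_value :: "bool list \<Rightarrow> bool list \<Rightarrow> wire \<Rightarrow> bool" where
  "wire_value z vs (Input i) = z ! i"
| "wire_value z vs (Const b) = b"
| "wire_value z vs (Gate i) = vs ! i"

fun gate_value :: "bool list \<Rightarrow> bool list \<Rightarrow> gate \<Rightarrow> bool" where
  "gate_value z vs (And u v) = (wire_value z vs u \<and> wire_value z vs v)"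
| "gate_value z vs (Or u v) = (wire_value z vs u \<or> wire_value z vs v)"
| "gate_value z vs (Not u) = (\<not> wire_value z vs u)"

definition circuit_value :: "circuit \<Rightarrow> bool list \<Rightarrow> bool" where
  "circuit_value c z =
     wire_value z (foldl (\<lambda>vs g. vs @ [gate_value z vs g]) [] (gates c)) (out_wire c)"

definition bitstrings :: "nat \<Rightarrow> bool list set" where
  "bitstrings m = {z. length z = m}"

text \<open>
  The distance \<open>d\<^sub>t(P, Q)\<close> of distributions on \<open>{0,1}\<^sup>m\<close>. The set of circuits is nonempty for
  every \<open>m\<close> and \<open>t\<close> (constant circuits have size 0) and the advantages lie in \<open>[0, 1]\<close>.
\<close>

definition comp_dist :: "nat \<Rightarrow> nat \<Rightarrow> bool list pmf \<Rightarrow> bool list pmf \<Rightarrow> real" where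
  "comp_dist m t P Q =
     (SUP A \<in> {A. wf_circuit m A \<and> circuit_size A \<le> t}.
        \<bar>measure_pmf.expectation P (\<lambda>z. of_bool (circuit_value A z))
          - measure_pmf.expectation Q (\<lambda>z. of_bool (circuit_value A z))\<bar>)"

definition tv_dist :: "'a pmf \<Rightarrow> 'a pmf \<Rightarrow> real" where
  "tv_dist P Q = (SUP S. \<bar>measure_pmf.prob P S - measure_pmf.prob Q S\<bar>)"

text \<open>
  \<open>k\<close> independent samples from \<open>D\<close>, concatenated, so that a distribution on \<open>{0,1}\<^sup>n\<close> yields
  one on \<open>{0,1}\<close>-strings of length \<open>k * n\<close>.
\<close>

definition power_pmf :: "nat \<Rightarrow> bool list pmf \<Rightarrow> bool list pmf" where
  "power_pmf k D = map_pmf concat (replicate_pmf k D)"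

end

(*
Let r = D0 + D1 and let L map {0,1}^n to O(1/eps^2) buckets. On a bucket of masses p, q under
D0, D1 put g = p / (p + q). A circuit f distinguishing D_b from the distribution built from g
raises the energy sum r g^2 (between 1/2 and 1) when the buckets are refined by f, so that this
happens at most about 1 / eps^2 times; merging buckets with nearly equal g after each step costs
little energy and keeps the overhead polynomial, whence the size grows only by a factor k + 1
per step. The built distributions are E0 = r g, E1 = r (1 - g), or, in order to keep D0, E0 = D0
and E1 = D0 q / p on buckets with p >= eta q and E1 = D1 elsewhere; there a step gains only about
eps^4. Since E_b and D_b agree on buckets and E0 / E1 depends on the bucket only, an approximate
likelihood ratio test for k samples is a small circuit on top of k copies of L, and it has the
same advantage on the D_b as on the E_b. This is the upper bound on the total variation distance.
The lower bound comes from interpolating between E_b and D_b.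
*)

theory Submission
  imports Defs
begin

subsection \<open>Circuits\<close>

text \<open>The size \<open>s'\<close> has two roles: the pair must fool all circuits of size
  \<open>s'\<close>, and some circuit of size \<open>s'\<close> must carry out the likelihood test,
  which contains \<open>k\<close> copies of the label function. So a partition has to withstand
  circuits larger than itself. With labels of size \<open>t\<close> this means
  \<open>s' = s + k * t + P\<close>, where \<open>P\<close> pays for the rest of the test. A
  distinguisher of that size spoils the current partition but is then absorbed into the next one,
  whose labels have size about \<open>t + s'\<close>; this is the origin of the factor
  \<open>k + 1\<close>.

  Without merging, the number of buckets could double in each step, and the transition tables would
  become exponential in \<open>1 / \<epsilon>\<^sup>2\<close>. Rounding ratios to multiples of
  \<open>1 / m\<close> loses energy of order \<open>1 / m\<^sup>2\<close>. For the balanced pair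
  \<open>m\<close> of order \<open>1 / \<epsilon>\<close> would do, but the variant that keeps
  \<open>D0\<close> gains only about \<open>\<epsilon> ^ 4\<close> per step; hence \<open>m\<close>
  is about \<open>4 / \<epsilon>\<^sup>2\<close> in both.\<close>

definition run_gates :: "bool list \<Rightarrow> gate list \<Rightarrow> bool list" where
  "run_gates z gs = foldl (\<lambda>vs g. vs @ [gate_value z vs g]) [] gs"

definition wf_gates :: "nat \<Rightarrow> gate list \<Rightarrow> bool" where
  "wf_gates m gs \<longleftrightarrow> (\<forall>j < length gs. gate_ok m j (gs ! j))"

definition computes :: "nat \<Rightarrow> gate list \<Rightarrow> (bool list \<Rightarrow> bool) \<Rightarrow> bool" where
  "computes m gs f \<longleftrightarrow>
     (\<exists>w. wire_ok m (length gs) w \<and> (\<forall>z\<in>bitstrings m. wire_value z (run_gates z gs) w = f z))"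

text \<open>One program serves the whole family and its gates are counted once, so all labels of a
  partition cost \<open>t\<close> together, not \<open>t\<close> each.\<close>

definition realizable :: "nat \<Rightarrow> nat \<Rightarrow> (bool list \<Rightarrow> bool) set \<Rightarrow> bool" where
  "realizable m t F \<longleftrightarrow> (\<exists>gs. wf_gates m gs \<and> length gs \<le> t \<and> (\<forall>f\<in>F. computes m gs f))"

lemma run_gates_simps [simp]:
  "run_gates z [] = []"
  "run_gates z (gs @ [g]) = run_gates z gs @ [gate_value z (run_gates z gs) g]"
  by (simp_all add: run_gates_def)

lemma length_run_gates [simp]: "length (run_gates z gs) = length gs"
  by (induction gs rule: rev_induct) auto

lemma wf_gates_snoc [simp]:
  "wf_gates m (gs @ [g]) \<longleftrightarrow> wf_gates m gs \<and> gate_ok m (length gs) g"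
  by (auto simp: wf_gates_def nth_append less_Suc_eq)

lemma wf_gates_Nil [simp]: "wf_gates m []"
  by (simp add: wf_gates_def)

lemma wire_value_append:
  "wire_ok m (length vs) w \<Longrightarrow> wire_value z (vs @ vs') w = wire_value z vs w"
  by (cases w) (auto simp: nth_append)

lemma wire_ok_mono: "wire_ok m j w \<Longrightarrow> j \<le> j' \<Longrightarrow> wire_ok m j' w"
  by (cases w) auto

lemma computes_snoc:
  assumes "computes m gs f"
  shows "computes m (gs @ [g]) f"
proof -
  obtain w where w: "wire_ok m (length gs) w"
      "\<forall>z\<in>bitstrings m. wire_value z (run_gates z gs) w = f z"
    using assms by (auto simp: computes_def)
  then show ?thesis
    unfolding computes_def
    by (intro exI[of _ w]) (auto simp: wire_value_append[where m=m] elim: wire_ok_mono)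
qed

lemma realizable_mono:
  "realizable m t F \<Longrightarrow> t \<le> t' \<Longrightarrow> F' \<subseteq> F \<Longrightarrow> realizable m t' F'"
  unfolding realizable_def using order_trans by blast

lemma realizable_cong:
  assumes "realizable m t F"
    and "\<And>f'. f' \<in> F' \<Longrightarrow> \<exists>f\<in>F. \<forall>z\<in>bitstrings m. f' z = f z"
  shows "realizable m t F'"
proof -
  obtain gs where gs: "wf_gates m gs" "length gs \<le> t" "\<And>f. f\<in>F \<Longrightarrow> computes m gs f"
    using assms(1) by (auto simp: realizable_def)
  have "computes m gs f'" if "f' \<in> F'" for f'
  proof -
    obtain f where "f \<in> F" "\<forall>z\<in>bitstrings m. f' z = f z"
      using assms(2)[OF \<open>f' \<in> F'\<close>] by blast
    then show ?thesis using gs(3)[of f] by (auto simp: computes_def)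
  qed
  with gs show ?thesis by (auto simp: realizable_def)
qed

lemma realizable_const:
  assumes "realizable m t F"
  shows "realizable m t (insert (\<lambda>_. b) F)"
proof -
  have "computes m gs (\<lambda>_. b)" for gs
    unfolding computes_def by (rule exI[of _ "Const b"]) auto
  with assms show ?thesis by (auto simp: realizable_def)
qed

lemma realizable_empty: "realizable m 0 {}"
  by (auto simp: realizable_def intro!: exI[of _ "[]"])

lemma realizable_consts: "realizable m 0 (range (\<lambda>b _. b))"
proof -
  have "realizable m 0 {\<lambda>_. True, \<lambda>_. False}"
    by (intro realizable_const realizable_empty)
  moreover have "range (\<lambda>b _. b) \<subseteq> {\<lambda>_::bool list. True, \<lambda>_. False}"
  proof
    fix f :: "bool list \<Rightarrow> bool" assume "f \<in> range (\<lambda>b _. b)"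
    then obtain b where "f = (\<lambda>_. b)" by auto
    then show "f \<in> {\<lambda>_. True, \<lambda>_. False}" by (cases b) auto
  qed
  ultimately show ?thesis by (rule realizable_mono[OF _ order.refl])
qed

text \<open>The second premise ranges over all programs because the wires of the operands are known
  only once a program is fixed.\<close>

lemma realizable_gate:
  assumes "realizable m t F"
    and "\<And>gs. (\<And>f. f \<in> F \<Longrightarrow> computes m gs f) \<Longrightarrow>
      \<exists>g. gate_ok m (length gs) g \<and> (\<forall>z\<in>bitstrings m. gate_value z (run_gates z gs) g = h z)"
  shows "realizable m (Suc t) (insert h F)"
proof -
  obtain gs where gs: "wf_gates m gs" "length gs \<le> t" "\<And>f. f\<in>F \<Longrightarrow> computes m gs f"
    using assms(1) by (auto simp: realizable_def)
  obtain g where g: "gate_ok m (length gs) g"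
      "\<And>z. z\<in>bitstrings m \<Longrightarrow> gate_value z (run_gates z gs) g = h z"
    using assms(2) gs(3) by blast
  have "computes m (gs @ [g]) h"
    unfolding computes_def
    by (rule exI[of _ "Gate (length gs)"]) (auto simp: g nth_append)
  then show ?thesis
    using gs g by (auto simp: realizable_def computes_snoc intro!: exI[of _ "gs @ [g]"])
qed

lemma realizable_conj:
  assumes "realizable m t F" "f \<in> F" "g \<in> F"
  shows "realizable m (Suc t) (insert (\<lambda>z. f z \<and> g z) F)"
proof (rule realizable_gate[OF assms(1)])
  fix gs assume *: "\<And>f. f \<in> F \<Longrightarrow> computes m gs f"
  obtain u where "wire_ok m (length gs) u" "\<forall>z\<in>bitstrings m. wire_value z (run_gates z gs) u = f z"
    using *[OF assms(2)] unfolding computes_def by blast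
  moreover obtain v where "wire_ok m (length gs) v" "\<forall>z\<in>bitstrings m. wire_value z (run_gates z gs) v = g z"
    using *[OF assms(3)] unfolding computes_def by blast
  ultimately show "\<exists>ga. gate_ok m (length gs) ga \<and> (\<forall>z\<in>bitstrings m. gate_value z (run_gates z gs) ga = (f z \<and> g z))"
    by (intro exI[of _ "And u v"]) auto
qed

lemma realizable_disj:
  assumes "realizable m t F" "f \<in> F" "g \<in> F"
  shows "realizable m (Suc t) (insert (\<lambda>z. f z \<or> g z) F)"
proof (rule realizable_gate[OF assms(1)])
  fix gs assume *: "\<And>f. f \<in> F \<Longrightarrow> computes m gs f"
  obtain u where "wire_ok m (length gs) u" "\<forall>z\<in>bitstrings m. wire_value z (run_gates z gs) u = f z"
    using *[OF assms(2)] unfolding computes_def by blast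
  moreover obtain v where "wire_ok m (length gs) v" "\<forall>z\<in>bitstrings m. wire_value z (run_gates z gs) v = g z"
    using *[OF assms(3)] unfolding computes_def by blast
  ultimately show "\<exists>ga. gate_ok m (length gs) ga \<and> (\<forall>z\<in>bitstrings m. gate_value z (run_gates z gs) ga = (f z \<or> g z))"
    by (intro exI[of _ "Or u v"]) auto
qed

lemma realizable_neg:
  assumes "realizable m t F" "f \<in> F"
  shows "realizable m (Suc t) (insert (\<lambda>z. \<not> f z) F)"
proof (rule realizable_gate[OF assms(1)])
  fix gs assume *: "\<And>f. f \<in> F \<Longrightarrow> computes m gs f"
  obtain u where "wire_ok m (length gs) u" "\<forall>z\<in>bitstrings m. wire_value z (run_gates z gs) u = f z"
    using *[OF assms(2)] unfolding computes_def by blast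
  then show "\<exists>ga. gate_ok m (length gs) ga \<and> (\<forall>z\<in>bitstrings m. gate_value z (run_gates z gs) ga = (\<not> f z))"
    by (intro exI[of _ "Not u"]) auto
qed

lemma realizable_bex:
  assumes "finite I" "realizable m t F" "\<And>i. i \<in> I \<Longrightarrow> f i \<in> F"
  shows "realizable m (t + card I) (insert (\<lambda>z. \<exists>i\<in>I. f i z) F)"
  using assms
proof (induction I rule: finite_induct)
  case empty
  then show ?case using realizable_const[of m t F False] by simp
next
  case (insert i I)
  let ?F = "Set.insert (\<lambda>z. \<exists>i\<in>I. f i z) F"
  have "realizable m (t + card I) ?F"
    using insert by auto
  then have "realizable m (Suc (t + card I)) (Set.insert (\<lambda>z. f i z \<or> (\<exists>i\<in>I. f i z)) ?F)"
    by (rule realizable_disj) (use insert.prems in simp_all)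
  moreover have "(\<lambda>z. \<exists>j\<in>Set.insert i I. f j z) = (\<lambda>z. f i z \<or> (\<exists>i\<in>I. f i z))"
    by simp
  ultimately show ?case
    using insert.hyps by (auto intro: realizable_mono)
qed

text \<open>Relocates a wire of a program on \<open>n\<close> inputs: inputs start at position \<open>a\<close>, gates at \<open>b\<close>.\<close>

fun shift_wire :: "nat \<Rightarrow> nat \<Rightarrow> wire \<Rightarrow> wire" where
  "shift_wire a b (Input i) = Input (a + i)"
| "shift_wire a b (Const c) = Const c"
| "shift_wire a b (Gate i) = Gate (b + i)"

fun shift_gate :: "nat \<Rightarrow> nat \<Rightarrow> gate \<Rightarrow> gate" where
  "shift_gate a b (And u v) = And (shift_wire a b u) (shift_wire a b v)"
| "shift_gate a b (Or u v) = Or (shift_wire a b u) (shift_wire a b v)"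
| "shift_gate a b (Not u) = Not (shift_wire a b u)"

lemma wire_ok_shift:
  "wire_ok n j w \<Longrightarrow> a + n \<le> m \<Longrightarrow> wire_ok m (b + j) (shift_wire a b w)"
  by (cases w) auto

lemma gate_ok_shift:
  "gate_ok n j g \<Longrightarrow> a + n \<le> m \<Longrightarrow> gate_ok m (b + j) (shift_gate a b g)"
  by (cases g) (auto simp: wire_ok_shift)

lemma wire_value_shift:
  assumes "wire_ok n (length vs') w" "a + n \<le> length z"
  shows "wire_value z (vs @ vs') (shift_wire a (length vs) w) = wire_value (take n (drop a z)) vs' w"
  using assms by (cases w) (auto simp: nth_append)

lemma gate_value_shift:
  assumes "gate_ok n (length vs') g" "a + n \<le> length z"
  shows "gate_value z (vs @ vs') (shift_gate a (length vs) g) = gate_value (take n (drop a z)) vs' g"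
  using assms by (cases g) (auto simp: wire_value_shift)

lemma wf_gates_append_shift:
  assumes "wf_gates n gs'" "wf_gates m gs" "a + n \<le> m"
  shows "wf_gates m (gs @ map (shift_gate a (length gs)) gs')"
  using assms
proof (induction gs' rule: rev_induct)
  case (snoc g gs')
  then show ?case
    using gate_ok_shift[of n "length gs'" g a m "length gs"]
    by (auto simp flip: append_assoc)
qed simp

lemma run_gates_append_shift:
  assumes "wf_gates n gs'" "a + n \<le> length z"
  shows "run_gates z (gs @ map (shift_gate a (length gs)) gs')
    = run_gates z gs @ run_gates (take n (drop a z)) gs'"
  using assms
proof (induction gs' rule: rev_induct)
  case (snoc g gs')
  then show ?case
    using gate_value_shift[of n "run_gates (take n (drop a z)) gs'" g a z "run_gates z gs"]
    by (auto simp flip: append_assoc)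
qed simp

text \<open>The second program reads only the \<open>n\<close> bits from position \<open>a\<close>
  on. With \<open>a = j * n\<close> it becomes the copy of a label program that handles one sample;
  with \<open>a = 0\<close> two programs share their input.\<close>

lemma realizable_union:
  assumes "realizable m t F" "realizable n t' F'" "a + n \<le> m"
  shows "realizable m (t + t') (F \<union> (\<lambda>f z. f (take n (drop a z))) ` F')"
proof -
  obtain gs where gs: "wf_gates m gs" "length gs \<le> t" "\<And>f. f\<in>F \<Longrightarrow> computes m gs f"
    using assms(1) by (auto simp: realizable_def)
  obtain gs' where gs': "wf_gates n gs'" "length gs' \<le> t'" "\<And>f. f\<in>F' \<Longrightarrow> computes n gs' f"
    using assms(2) by (auto simp: realizable_def)
  let ?gs = "gs @ map (shift_gate a (length gs)) gs'"
  have run: "run_gates z ?gs = run_gates z gs @ run_gates (take n (drop a z)) gs'"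
    if "z \<in> bitstrings m" for z
    using that assms(3) gs'(1) by (intro run_gates_append_shift) (auto simp: bitstrings_def)
  have "computes m ?gs f" if f: "f \<in> F" for f
  proof -
    obtain w where w: "wire_ok m (length gs) w" "\<forall>z\<in>bitstrings m. wire_value z (run_gates z gs) w = f z"
      using gs(3)[OF f] by (auto simp: computes_def)
    then show ?thesis
      unfolding computes_def
      by (intro exI[of _ w]) (auto simp: run wire_value_append[where m=m] elim: wire_ok_mono)
  qed
  moreover have "computes m ?gs (\<lambda>z. f (take n (drop a z)))" if f: "f \<in> F'" for f
  proof -
    obtain w where w: "wire_ok n (length gs') w" "\<forall>z\<in>bitstrings n. wire_value z (run_gates z gs') w = f z"
      using gs'(3)[OF f] by (auto simp: computes_def)
    have "wire_value z (run_gates z ?gs) (shift_wire a (length gs) w) = f (take n (drop a z))"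
      if z: "z \<in> bitstrings m" for z
    proof -
      have "take n (drop a z) \<in> bitstrings n"
        using z assms(3) by (auto simp: bitstrings_def)
      moreover have "a + n \<le> length z" using z assms(3) by (auto simp: bitstrings_def)
      ultimately show ?thesis
        using w wire_value_shift[of n "run_gates (take n (drop a z)) gs'" w a z "run_gates z gs"] run[OF z]
        by auto
    qed
    then show ?thesis
      unfolding computes_def using wire_ok_shift[OF w(1) assms(3)] by auto
  qed
  ultimately show ?thesis
    using wf_gates_append_shift[OF gs'(1) gs(1) assms(3)] gs(2) gs'(2)
    unfolding realizable_def by (intro exI[of _ ?gs]) auto
qed

lemma realizable_union_same:
  assumes "realizable m t F" "realizable m t' F'"
  shows "realizable m (t + t') (F \<union> F')"
proof (rule realizable_cong)
  show "realizable m (t + t') (F \<union> (\<lambda>f z. f (take m (drop 0 z))) ` F')"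
    using realizable_union[OF assms, of 0] by simp
  fix f assume f: "f \<in> F \<union> F'"
  let ?G = "F \<union> (\<lambda>f z. f (take m (drop 0 z))) ` F'"
  show "\<exists>g\<in>?G. \<forall>z\<in>bitstrings m. f z = g z"
  proof (cases "f \<in> F")
    case False
    then have "(\<lambda>z. f (take m (drop 0 z))) \<in> ?G"
      using f by (intro UnI2 imageI) simp
    then show ?thesis
      by (rule bexI[rotated]) (simp add: bitstrings_def)
  qed blast
qed

lemma realizable_iff_circuit:
  "realizable m t {f} \<longleftrightarrow>
     (\<exists>c. wf_circuit m c \<and> circuit_size c \<le> t \<and> (\<forall>z\<in>bitstrings m. circuit_value c z = f z))"
proof
  assume "realizable m t {f}"
  then obtain gs w where "wf_gates m gs" "length gs \<le> t" "wire_ok m (length gs) w"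
     "\<forall>z\<in>bitstrings m. wire_value z (run_gates z gs) w = f z"
    by (auto simp: realizable_def computes_def)
  then show "\<exists>c. wf_circuit m c \<and> circuit_size c \<le> t \<and> (\<forall>z\<in>bitstrings m. circuit_value c z = f z)"
    by (intro exI[of _ "Circuit gs w"])
      (auto simp: wf_circuit_def wf_gates_def circuit_size_def circuit_value_def run_gates_def)
next
  assume "\<exists>c. wf_circuit m c \<and> circuit_size c \<le> t \<and> (\<forall>z\<in>bitstrings m. circuit_value c z = f z)"
  then show "realizable m t {f}"
    unfolding realizable_def computes_def wf_circuit_def wf_gates_def circuit_size_def
        circuit_value_def run_gates_def by blast
qed

text \<open>Unary code with one wire per value: any function of two coded numbers is a disjunction
  of conjunctions of wires, without decoding.\<close>

definition onehot :: "nat \<Rightarrow> (bool list \<Rightarrow> nat) \<Rightarrow> (bool list \<Rightarrow> bool) set" where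
  "onehot Q \<sigma> = (\<lambda>v z. \<sigma> z = v) ` {..<Q}"

text \<open>One conjunction per pair of values, then for each result the disjunction over its
  preimage under \<open>\<delta>\<close>. The preimages are disjoint, so all disjunctions together
  need at most \<open>Q * M\<close> gates, however large \<open>Q'\<close> is.\<close>

lemma realizable_onehot_combine:
  assumes F: "realizable m t F" "onehot Q \<sigma> \<subseteq> F" "onehot M L \<subseteq> F"
    and \<sigma>: "\<And>z. z \<in> bitstrings m \<Longrightarrow> \<sigma> z < Q"
    and L: "\<And>z. z \<in> bitstrings m \<Longrightarrow> L z < M"
  shows "realizable m (t + 2 * (Q * M)) (onehot Q' (\<lambda>z. \<delta> (\<sigma> z) (L z)))"
proof -
  define I where "I = {..<Q} \<times> {..<M}"
  define c where "c = (\<lambda>(u, i) z. \<sigma> z = u \<and> L z = i)"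
  have fin: "finite J" if "J \<subseteq> I" for J
    using that by (rule finite_subset) (simp add: I_def)
  have ands: "realizable m (t + card J) (F \<union> c ` J)" if "J \<subseteq> I" for J
    using fin[OF that] that
  proof (induction J rule: finite_induct)
    case empty
    then show ?case using F by simp
  next
    case (insert p J)
    obtain u i where p: "p = (u, i)" by force
    have "(\<lambda>z. \<sigma> z = u) \<in> F" "(\<lambda>z. L z = i) \<in> F"
      using F insert.prems by (auto simp: p I_def onehot_def)
    then have "realizable m (Suc (t + card J)) (Set.insert (\<lambda>z. \<sigma> z = u \<and> L z = i) (F \<union> c ` J))"
      using insert by (intro realizable_conj) auto
    then show ?case using insert by (simp add: p c_def)
  qed
  define J where "J v = {p\<in>I. case_prod \<delta> p = v}" for v
  have ors: "realizable m (t + card I + (\<Sum>v<w. card (J v)))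
      (F \<union> c ` I \<union> (\<lambda>v z. \<exists>p\<in>J v. c p z) ` {..<w})" for w
  proof (induction w)
    case 0
    then show ?case using ands[of I] by simp
  next
    case (Suc w)
    have "realizable m (t + card I + (\<Sum>v<w. card (J v)) + card (J w))
      (insert (\<lambda>z. \<exists>p\<in>J w. c p z) (F \<union> c ` I \<union> (\<lambda>v z. \<exists>p\<in>J v. c p z) ` {..<w}))"
      by (rule realizable_bex[OF _ Suc]) (auto simp: J_def intro: fin)
    then show ?case by (simp add: lessThan_Suc ac_simps)
  qed
  have "(\<Sum>v<Q'. card (J v)) = card (\<Union>v<Q'. J v)"
    by (rule card_UN_disjoint[symmetric]) (auto simp: J_def intro: fin)
  also have "\<dots> \<le> card I" by (intro card_mono) (auto simp: J_def I_def)
  finally have "(\<Sum>v<Q'. card (J v)) \<le> card I" .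
  moreover have "card I = Q * M" by (simp add: I_def)
  ultimately have le: "t + card I + (\<Sum>v<Q'. card (J v)) \<le> t + 2 * (Q * M)"
    by linarith
  have "realizable m (t + 2 * (Q * M)) (F \<union> c ` I \<union> (\<lambda>v z. \<exists>p\<in>J v. c p z) ` {..<Q'})"
    by (rule realizable_mono[OF ors le]) simp
  then show ?thesis
  proof (rule realizable_cong)
    fix f assume "f \<in> onehot Q' (\<lambda>z. \<delta> (\<sigma> z) (L z))"
    then obtain v where v: "v < Q'" "f = (\<lambda>z. \<delta> (\<sigma> z) (L z) = v)" by (auto simp: onehot_def)
    then have "\<forall>z\<in>bitstrings m. f z = (\<exists>p\<in>J v. c p z)"
      using \<sigma> L by (auto simp: J_def I_def c_def)
    moreover have "(\<lambda>z. \<exists>p\<in>J v. c p z) \<in> (\<lambda>v z. \<exists>p\<in>J v. c p z) ` {..<Q'}"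
      by (rule imageI) (simp add: v)
    ultimately show "\<exists>g\<in>F \<union> c ` I \<union> (\<lambda>v z. \<exists>p\<in>J v. c p z) ` {..<Q'}. \<forall>z\<in>bitstrings m. f z = g z"
      by (intro bexI[where x = "\<lambda>z. \<exists>p\<in>J v. c p z"] UnI2)
  qed
qed

text \<open>Each block costs a fresh copy of the label program and one transition table. The
  induction is on the number \<open>j\<close> of blocks read, while the input length stays
  \<open>k * n\<close>, so that a program can be extended in place.\<close>

lemma realizable_automaton:
  assumes L: "realizable n t (onehot M L)" "\<And>z. z \<in> bitstrings n \<Longrightarrow> L z < M"
    and q0: "q0 < Q" and \<delta>: "\<And>u i. u < Q \<Longrightarrow> i < M \<Longrightarrow> \<delta> u i < Q"
    and "j \<le> k"
  shows "realizable (k * n) (j * (t + 2 * (Q * M)))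
     (onehot Q (\<lambda>z. foldl \<delta> q0 (map (\<lambda>i. L (take n (drop (i * n) z))) [0..<j])))"
  using \<open>j \<le> k\<close>
proof (induction j)
  case 0
  have "onehot Q (\<lambda>z. q0) \<subseteq> range (\<lambda>b _. b)" by (auto simp: onehot_def)
  then show ?case using realizable_mono[OF realizable_consts] by simp
next
  case (Suc j)
  let ?s = "\<lambda>j z. foldl \<delta> q0 (map (\<lambda>i. L (take n (drop (i * n) z))) [0..<j])"
  let ?b = "\<lambda>z. take n (drop (j * n) z)"
  have jn: "j * n + n \<le> k * n"
    using Suc.prems mult_le_mono1[of "Suc j" k n] by simp
  have L': "L (take n (drop (i * n) z)) < M" if "z \<in> bitstrings (k * n)" "i \<le> j" for z i
  proof -
    have "i * n + n \<le> k * n"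
      using jn mult_le_mono1[OF that(2), of n] by linarith
    then show ?thesis
      using that by (intro L(2)) (auto simp: bitstrings_def)
  qed
  have s: "?s i z < Q" if "z \<in> bitstrings (k * n)" "i \<le> j" for z i
    using that(2)
  proof (induction i)
    case (Suc i)
    then show ?case using \<delta> L'[OF that(1), of i] by simp
  qed (use q0 in auto)
  have "realizable (k * n) (j * (t + 2 * (Q * M)) + t)
      (onehot Q (?s j) \<union> (\<lambda>f z. f (?b z)) ` onehot M L)"
    by (rule realizable_union[OF _ L(1) jn]) (use Suc in simp)
  then have *: "realizable (k * n) (j * (t + 2 * (Q * M)) + t)
      (onehot Q (?s j) \<union> onehot M (\<lambda>z. L (?b z)))"
    by (simp add: onehot_def image_image)
  have "realizable (k * n) (j * (t + 2 * (Q * M)) + t + 2 * (Q * M))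
      (onehot Q (\<lambda>z. \<delta> (?s j z) (L (?b z))))"
    by (rule realizable_onehot_combine[OF * Un_upper1 Un_upper2]) (auto intro: s L')
  then show ?case by (simp add: ac_simps)
qed

subsection \<open>Total variation and computational distance\<close>

lemma prob_eq_sum:
  assumes "finite A" "set_pmf P \<subseteq> A"
  shows "measure_pmf.prob P S = (\<Sum>x\<in>A. pmf P x * of_bool (x \<in> S))"
proof -
  have "measure_pmf.prob P S = measure_pmf.prob P (A \<inter> S)"
    using assms by (intro measure_pmf.finite_measure_eq_AE) (auto simp: AE_measure_pmf_iff)
  also have "\<dots> = (\<Sum>x\<in>A \<inter> S. pmf P x)"
    using assms by (intro measure_measure_pmf_finite) auto
  also have "\<dots> = (\<Sum>x\<in>A. pmf P x * of_bool (x \<in> S))"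
    using assms(1) by (intro sum.mono_neutral_cong_left) auto
  finally show ?thesis .
qed

lemma tv_dist_bdd: "bdd_above (range (\<lambda>S. \<bar>measure_pmf.prob P S - measure_pmf.prob Q S\<bar>))"
proof (rule bdd_aboveI2)
  fix S
  show "\<bar>measure_pmf.prob P S - measure_pmf.prob Q S\<bar> \<le> 1"
    using measure_pmf.prob_le_1[of P S] measure_pmf.prob_le_1[of Q S]
      measure_nonneg[of P S] measure_nonneg[of Q S] by linarith
qed

lemma tv_dist_ge: "\<bar>measure_pmf.prob P S - measure_pmf.prob Q S\<bar> \<le> tv_dist P Q"
  unfolding tv_dist_def by (rule cSUP_upper[OF UNIV_I tv_dist_bdd])

text \<open>Passing to the complement flips the sign of the difference, so a one-sided bound
  suffices.\<close>

lemma tv_dist_le: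
  assumes "\<And>S. measure_pmf.prob P S - measure_pmf.prob Q S \<le> c"
  shows "tv_dist P Q \<le> c"
  unfolding tv_dist_def
proof (rule cSUP_least)
  fix S
  have "measure_pmf.prob P (- S) = 1 - measure_pmf.prob P S" for P :: "'a pmf"
    using measure_pmf.prob_compl[of S P] by (simp add: Compl_eq_Diff_UNIV)
  then show "\<bar>measure_pmf.prob P S - measure_pmf.prob Q S\<bar> \<le> c"
    using assms[of S] assms[of "- S"] by simp
qed simp

lemma tv_dist_nonneg: "0 \<le> tv_dist P Q"
  using tv_dist_ge[of P "{}" Q] by simp

lemma tv_dist_le_1: "tv_dist P Q \<le> 1"
  using measure_pmf.prob_le_1[of P] measure_nonneg[of Q]
  by (intro tv_dist_le) (smt (verit, best))

text \<open>The supremum is attained where \<open>P\<close> outweighs \<open>Q\<close>. The closed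
  form also makes the distance visibly continuous in the point probabilities.\<close>

lemma tv_dist_eq_sum:
  assumes "finite A" "set_pmf P \<subseteq> A" "set_pmf Q \<subseteq> A"
  shows "tv_dist P Q = (\<Sum>x\<in>A. max 0 (pmf P x - pmf Q x))"
proof (rule antisym)
  note sums = prob_eq_sum[OF assms(1,2)] prob_eq_sum[OF assms(1,3)]
  show "tv_dist P Q \<le> (\<Sum>x\<in>A. max 0 (pmf P x - pmf Q x))"
    unfolding sums sum_subtractf[symmetric] by (intro tv_dist_le) (auto simp: sums simp flip: sum_subtractf intro!: sum_mono)
  have "(\<Sum>x\<in>A. max 0 (pmf P x - pmf Q x))
      = measure_pmf.prob P {x. pmf Q x \<le> pmf P x} - measure_pmf.prob Q {x. pmf Q x \<le> pmf P x}"
    unfolding sums sum_subtractf[symmetric] by (intro sum.cong) auto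
  then show "(\<Sum>x\<in>A. max 0 (pmf P x - pmf Q x)) \<le> tv_dist P Q"
    using tv_dist_ge[of P "{x. pmf Q x \<le> pmf P x}" Q] by simp
qed

lemma tv_dist_map_le: "tv_dist (map_pmf f P) (map_pmf f Q) \<le> tv_dist P Q"
proof (rule tv_dist_le)
  fix S
  show "measure_pmf.prob (map_pmf f P) S - measure_pmf.prob (map_pmf f Q) S \<le> tv_dist P Q"
    using tv_dist_ge[of P "f -` S" Q] by simp
qed

section \<open>Independent samples and the rounded likelihood ratio test\<close>

lemma pmf_replicate_pmf:
  "pmf (replicate_pmf k P) xs = (if length xs = k then prod_list (map (pmf P) xs) else 0)"
proof (induction k arbitrary: xs)
  case 0
  then show ?case by (auto simp: indicator_def)
next
  case (Suc k)
  have eq: "replicate_pmf (Suc k) P = map_pmf (\<lambda>(x, ys). x # ys) (pair_pmf P (replicate_pmf k P))"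
    by (simp add: pair_pmf_def map_bind_pmf)
  show ?case
  proof (cases xs)
    case Nil
    then have "xs \<notin> set_pmf (replicate_pmf (Suc k) P)" by (simp add: set_replicate_pmf)
    then show ?thesis using Nil by (simp add: pmf_eq_0_set_pmf del: replicate_pmf.simps)
  next
    case (Cons x ys)
    have "pmf (replicate_pmf (Suc k) P) ((\<lambda>(x, ys). x # ys) (x, ys)) = pmf (pair_pmf P (replicate_pmf k P)) (x, ys)"
      unfolding eq by (rule pmf_map_inj') (auto simp: inj_on_def)
    then show ?thesis using Cons Suc by (simp add: pmf_pair del: replicate_pmf.simps)
  qed
qed

lemma map_replicate_pmf: "map_pmf (map f) (replicate_pmf k P) = replicate_pmf k (map_pmf f P)"
proof (induction k)
  case (Suc k)
  show ?case
    by (simp add: Suc[symmetric] map_bind_pmf bind_map_pmf)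
qed simp

lemma set_replicate_pmf_subset:
  "set_pmf P \<subseteq> X \<Longrightarrow> set_pmf (replicate_pmf k P) \<subseteq> {xs. set xs \<subseteq> X \<and> length xs = k}"
  by (auto simp: set_replicate_pmf)

lemma prob_replicate_pmf_subset:
  "measure_pmf.prob (replicate_pmf k P) {xs. set xs \<subseteq> G} = measure_pmf.prob P G ^ k"
proof -
  let ?B = "map_pmf (\<lambda>x. x \<in> G) P"
  have len: "length xs = k" if "xs \<in> set_pmf (replicate_pmf k P)" for xs
    using that by (simp add: set_replicate_pmf)
  have "measure_pmf.prob (replicate_pmf k P) {xs. set xs \<subseteq> G}
     = measure_pmf.prob (replicate_pmf k P) (map (\<lambda>x. x \<in> G) -` {replicate k True})"
    by (intro measure_pmf.finite_measure_eq_AE)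
      (auto simp: AE_measure_pmf_iff list_eq_iff_nth_eq subset_iff in_set_conv_nth dest!: len)
  also have "\<dots> = pmf (replicate_pmf k ?B) (replicate k True)"
    by (simp add: map_replicate_pmf[symmetric] pmf_map)
  also have "\<dots> = measure_pmf.prob P G ^ k"
    by (simp add: pmf_replicate_pmf prod_list_replicate pmf_map vimage_def)
  finally show ?thesis .
qed

text \<open>The union bound, obtained from the exact probability by Bernoulli's inequality.\<close>

lemma prob_replicate_pmf_not_subset:
  "measure_pmf.prob (replicate_pmf k P) {xs. \<not> set xs \<subseteq> G} \<le> k * measure_pmf.prob P (- G)"
proof -
  let ?p = "measure_pmf.prob P (- G)"
  have compl: "measure_pmf.prob M (- S) = 1 - measure_pmf.prob M S" for S and M :: "'b pmf"
    using measure_pmf.prob_compl[of S M] by (simp add: Compl_eq_Diff_UNIV)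
  have "{xs. \<not> set xs \<subseteq> G} = - {xs. set xs \<subseteq> G}" by auto
  then have "measure_pmf.prob (replicate_pmf k P) {xs. \<not> set xs \<subseteq> G} = 1 - (1 - ?p) ^ k"
    by (simp only: compl prob_replicate_pmf_subset) simp
  moreover have "1 + real k * (- ?p) \<le> (1 + - ?p) ^ k"
    by (rule Bernoulli_inequality) (use measure_pmf.prob_le_1[of P "- G"] in linarith)
  ultimately show ?thesis by simp
qed

lemma prod_list_map_nonneg: "(\<And>x. 0 \<le> f x) \<Longrightarrow> 0 \<le> prod_list (map f xs)" for f :: "_ \<Rightarrow> real"
  by (induction xs) auto

text \<open>Since the pointwise ratios are compared with powers of one base, the ratio of the
  product measures is governed by a sum of natural numbers, which an automaton can
  accumulate.\<close>

lemma prod_list_le_power: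
  fixes f g :: "'a \<Rightarrow> real"
  assumes "\<And>x. x \<in> set xs \<Longrightarrow> b ^ (e x) * c * g x \<le> f x" "\<And>x. 0 \<le> g x" "0 \<le> b" "0 \<le> c"
  shows "b ^ (sum_list (map e xs)) * c ^ length xs * prod_list (map g xs) \<le> prod_list (map f xs)"
  using assms(1)
proof (induction xs)
  case (Cons x xs)
  have "(b ^ (e x) * c * g x) * (b ^ (sum_list (map e xs)) * c ^ length xs * prod_list (map g xs))
      \<le> f x * prod_list (map f xs)"
  proof (rule mult_mono')
    show "0 \<le> b ^ e x * c * g x" "0 \<le> b ^ sum_list (map e xs) * c ^ length xs * prod_list (map g xs)"
      using assms prod_list_map_nonneg[of g xs] by auto
  qed (use Cons in auto)
  then show ?case by (simp add: power_add ac_simps)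
qed simp

lemma prod_list_ge_power:
  fixes f g :: "'a \<Rightarrow> real"
  assumes "\<And>x. x \<in> set xs \<Longrightarrow> f x \<le> b ^ (e x) * c * g x" "\<And>x. 0 \<le> f x" "\<And>x. 0 \<le> g x" "0 \<le> b" "0 \<le> c"
  shows "prod_list (map f xs) \<le> b ^ (sum_list (map e xs)) * c ^ length xs * prod_list (map g xs)"
  using assms(1)
proof (induction xs)
  case (Cons x xs)
  have "f x * prod_list (map f xs)
      \<le> (b ^ (e x) * c * g x) * (b ^ (sum_list (map e xs)) * c ^ length xs * prod_list (map g xs))"
  proof (rule mult_mono')
    show "0 \<le> f x" "0 \<le> prod_list (map f xs)"
      using assms prod_list_map_nonneg[of f xs] by auto
  qed (use Cons in auto)
  then show ?case by (simp add: power_add ac_simps)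
qed simp

text \<open>Turns the multiplicative error of \<open>k\<close> roundings into an additive one that
  is linear in \<open>k\<close>.\<close>

lemma one_minus_inverse_power_le:
  fixes b :: real
  assumes "1 \<le> b"
  shows "1 - 1 / b ^ k \<le> k * (b - 1)"
proof -
  have "1 + real k * (1 / b - 1) \<le> (1 + (1 / b - 1)) ^ k"
    by (rule Bernoulli_inequality) (use assms in simp)
  then have "1 - 1 / b ^ k \<le> real k * (1 - 1 / b)"
    by (simp add: power_divide right_diff_distrib)
  also have "1 - 1 / b \<le> b - 1"
  proof -
    have "0 \<le> (b - 1)\<^sup>2" by simp
    then have "2 * b - 1 \<le> b * b" by (simp add: power2_eq_square algebra_simps)
    then show ?thesis using assms by (simp add: field_simps)
  qed
  then have "real k * (1 - 1 / b) \<le> real k * (b - 1)"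
    by (intro mult_left_mono) auto
  finally show ?thesis .
qed

text \<open>
  The weights \<open>h\<close> are the likelihood ratios rounded to powers of \<open>\<beta>\<close>, with unit \<open>\<eta>\<close>. The
  threshold test \<open>T\<close> can deviate from the likelihood ratio test only where the ratio of the two
  product measures is between \<open>1\<close> and \<open>\<beta> ^ k\<close>, or on samples with a point outside \<open>G\<close>.
\<close>

lemma tv_dist_threshold_test:
  fixes E0 E1 :: "'a pmf" and h :: "'a \<Rightarrow> nat"
  assumes X: "finite X" "set_pmf E0 \<subseteq> X" "set_pmf E1 \<subseteq> X"
    and \<beta>: "1 \<le> \<beta>" and \<eta>: "0 < \<eta>"
    and \<tau>: "1 \<le> \<beta> ^ \<tau> * \<eta> ^ k" "\<And>j. j < \<tau> \<Longrightarrow> \<beta> ^ j * \<eta> ^ k \<le> 1"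
    and lower: "\<And>x. x \<in> X \<Longrightarrow> x \<in> G \<Longrightarrow> \<beta> ^ h x * \<eta> * pmf E1 x \<le> pmf E0 x"
    and upper: "\<And>x. x \<in> X \<Longrightarrow> x \<in> G \<Longrightarrow> h x < \<tau> \<Longrightarrow> pmf E0 x \<le> \<beta> ^ Suc (h x) * \<eta> * pmf E1 x"
  defines "T \<equiv> {xs. set xs \<subseteq> G \<and> \<tau> \<le> sum_list (map h xs)}"
  shows "tv_dist (replicate_pmf k E0) (replicate_pmf k E1)
    \<le> measure_pmf.prob (replicate_pmf k E0) T - measure_pmf.prob (replicate_pmf k E1) T
      + k * (measure_pmf.prob E0 (- G) + (\<beta> - 1))"
proof -
  define A where "A = {xs. set xs \<subseteq> X \<and> length xs = k}"
  have A: "finite A" unfolding A_def by (rule finite_lists_length_eq[OF X(1)])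
  have sub: "set_pmf (replicate_pmf k E0) \<subseteq> A" "set_pmf (replicate_pmf k E1) \<subseteq> A"
    unfolding A_def by (rule set_replicate_pmf_subset, fact X)+
  note sums = prob_eq_sum[OF A sub(1)] prob_eq_sum[OF A sub(2)]
  let ?p = "pmf (replicate_pmf k E0)" and ?q = "pmf (replicate_pmf k E1)"
  \<comment> \<open>Below the threshold the likelihood ratio is at most \<open>\<beta> ^ k\<close>,
    so the excess of \<open>?p xs\<close> over \<open>?q xs\<close> is at most the fraction
    \<open>c\<close> of \<open>?p xs\<close>.\<close>
  define c where "c = 1 - 1 / \<beta> ^ k"
  have c: "0 \<le> c" using one_le_power[OF \<beta>, of k] by (simp add: c_def)
  let ?N = "{xs. \<not> set xs \<subseteq> G}"
  have pointwise: "max 0 (?p xs - ?q xs)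
      \<le> (?p xs * of_bool (xs \<in> T) - ?q xs * of_bool (xs \<in> T)) + ?p xs * of_bool (xs \<in> ?N) + c * ?p xs"
    if xs: "xs \<in> A" for xs
  proof -
    have len: "length xs = k" and X': "set xs \<subseteq> X" using xs by (auto simp: A_def)
    have p: "?p xs = prod_list (map (pmf E0) xs)" and q: "?q xs = prod_list (map (pmf E1) xs)"
      by (simp_all add: pmf_replicate_pmf len)
    have pq: "0 \<le> ?p xs" "0 \<le> ?q xs" "0 \<le> c * ?p xs" using c by auto
    consider "xs \<in> ?N" | "xs \<in> T" | "set xs \<subseteq> G" "xs \<notin> T" by auto
    then show ?thesis
    proof cases
      case 1
      then have "xs \<notin> T" by (auto simp: T_def)
      moreover have "max 0 (?p xs - ?q xs) \<le> ?p xs" using pq by auto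
      moreover have "?p xs * of_bool (xs \<in> ?N) = ?p xs" using 1 by simp
      moreover have "?p xs * of_bool (xs \<in> T) - ?q xs * of_bool (xs \<in> T) = 0"
        using \<open>xs \<notin> T\<close> by simp
      ultimately show ?thesis using pq(3) by linarith
    next
      case 2
      then have G: "set xs \<subseteq> G" and s: "\<tau> \<le> sum_list (map h xs)" by (auto simp: T_def)
      have "1 \<le> \<beta> ^ \<tau> * \<eta> ^ k" by fact
      also have "\<dots> \<le> \<beta> ^ sum_list (map h xs) * \<eta> ^ k"
        using \<beta> \<eta> s by (intro mult_right_mono power_increasing) auto
      finally have "?q xs \<le> \<beta> ^ sum_list (map h xs) * \<eta> ^ k * ?q xs"
        using pq mult_right_mono by fastforce
      also have "\<beta> ^ sum_list (map h xs) * \<eta> ^ length xs * prod_list (map (pmf E1) xs)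
          \<le> prod_list (map (pmf E0) xs)"
        by (rule prod_list_le_power) (use lower G X' \<beta> \<eta> in auto)
      then have "\<beta> ^ sum_list (map h xs) * \<eta> ^ k * ?q xs \<le> ?p xs"
        by (simp add: p q len)
      finally show ?thesis using 2 G pq by (simp add: T_def)
    next
      case 3
      then have s: "sum_list (map h xs) < \<tau>" by (auto simp: T_def)
      \<comment> \<open>A sum below \<open>\<tau>\<close> forces every entry below
        \<open>\<tau>\<close>, which is where \<open>upper\<close> is available. Each of the
        \<open>k\<close> roundings then loses at most one factor \<open>\<beta>\<close>.\<close>
      have h: "h x < \<tau>" if "x \<in> set xs" for x
        using s member_le_sum_list[of "h x" "map h xs"] that by auto
      have "?p xs \<le> \<beta> ^ sum_list (map (\<lambda>x. Suc (h x)) xs) * \<eta> ^ length xs * ?q xs"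
        unfolding p q by (rule prod_list_ge_power) (use upper 3 X' h \<beta> \<eta> in auto)
      also have "sum_list (map (\<lambda>x. Suc (h x)) xs) = sum_list (map h xs) + k"
        unfolding len[symmetric] by (induction xs) auto
      also have "\<beta> ^ (sum_list (map h xs) + k) * \<eta> ^ length xs * ?q xs
          = (\<beta> ^ sum_list (map h xs) * \<eta> ^ k) * (\<beta> ^ k * ?q xs)"
        by (simp add: power_add len ac_simps)
      also have "\<dots> \<le> 1 * (\<beta> ^ k * ?q xs)"
        using \<beta> pq by (intro mult_right_mono \<tau>(2) s) auto
      finally have "?p xs / \<beta> ^ k \<le> ?q xs"
        using \<beta> by (simp add: divide_le_eq mult.commute)
      then have "?p xs - ?q xs \<le> c * ?p xs" by (simp add: c_def left_diff_distrib)
      then show ?thesis using 3 pq by simp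
    qed
  qed
  have "tv_dist (replicate_pmf k E0) (replicate_pmf k E1) = (\<Sum>xs\<in>A. max 0 (?p xs - ?q xs))"
    by (rule tv_dist_eq_sum[OF A sub])
  also have "\<dots> \<le> (\<Sum>xs\<in>A. (?p xs * of_bool (xs \<in> T) - ?q xs * of_bool (xs \<in> T))
      + ?p xs * of_bool (xs \<in> ?N) + c * ?p xs)"
    by (intro sum_mono pointwise)
  also have "\<dots> = measure_pmf.prob (replicate_pmf k E0) T - measure_pmf.prob (replicate_pmf k E1) T
      + measure_pmf.prob (replicate_pmf k E0) ?N + c * measure_pmf.prob (replicate_pmf k E0) UNIV"
    unfolding sums by (simp add: sum.distrib sum_subtractf sum_distrib_left)
  also have "\<dots> \<le> measure_pmf.prob (replicate_pmf k E0) T - measure_pmf.prob (replicate_pmf k E1) T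
      + k * measure_pmf.prob E0 (- G) + k * (\<beta> - 1)"
    using prob_replicate_pmf_not_subset[of k E0 G] one_minus_inverse_power_le[OF \<beta>, of k]
    by (simp add: c_def)
  finally show ?thesis by (simp add: distrib_left)
qed

section \<open>Mixtures and the continuity of the distance along them\<close>

definition mix_pmf :: "real \<Rightarrow> 'a pmf \<Rightarrow> 'a pmf \<Rightarrow> 'a pmf" where
  "mix_pmf l P Q = bernoulli_pmf l \<bind> (\<lambda>b. if b then Q else P)"

lemma pmf_mix_pmf: "0 \<le> l \<Longrightarrow> l \<le> 1 \<Longrightarrow> pmf (mix_pmf l P Q) x = (1 - l) * pmf P x + l * pmf Q x"
  by (simp add: mix_pmf_def pmf_bind)

lemma set_mix_pmf: "set_pmf P \<subseteq> A \<Longrightarrow> set_pmf Q \<subseteq> A \<Longrightarrow> set_pmf (mix_pmf l P Q) \<subseteq> A"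
  by (auto simp: mix_pmf_def split: if_splits)

lemma mix_pmf_same [simp]: "mix_pmf l P P = P"
  by (simp add: mix_pmf_def)

lemma mix_pmf_0 [simp]: "mix_pmf 0 P Q = P" and mix_pmf_1 [simp]: "mix_pmf 1 P Q = Q"
  by (rule pmf_eqI; simp add: pmf_mix_pmf)+

lemma prob_mix_pmf:
  assumes "finite A" "set_pmf P \<subseteq> A" "set_pmf Q \<subseteq> A" "0 \<le> l" "l \<le> 1"
  shows "measure_pmf.prob (mix_pmf l P Q) S
    = (1 - l) * measure_pmf.prob P S + l * measure_pmf.prob Q S"
  unfolding prob_eq_sum[OF assms(1,2)] prob_eq_sum[OF assms(1,3)]
    prob_eq_sum[OF assms(1) set_mix_pmf[OF assms(2,3)]] sum_distrib_left sum.distrib[symmetric]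
  using assms by (intro sum.cong) (auto simp: pmf_mix_pmf)

lemma pmf_power_pmf:
  assumes "finite X" "set_pmf P \<subseteq> X"
  shows "pmf (power_pmf k P) z
    = (\<Sum>xs\<in>{xs. set xs \<subseteq> X \<and> length xs = k}. prod_list (map (pmf P) xs) * of_bool (concat xs = z))"
  unfolding power_pmf_def pmf_map
  by (subst prob_eq_sum[OF finite_lists_length_eq[OF assms(1)] set_replicate_pmf_subset[OF assms(2)]])
    (auto simp: pmf_replicate_pmf intro!: sum.cong)

text \<open>For fixed \<open>z\<close> this is a polynomial in \<open>l\<close>: a finite sum of
  products of \<open>k\<close> affine functions.\<close>

lemma continuous_on_pmf_power_mix:
  assumes "finite X" "set_pmf P \<subseteq> X" "set_pmf Q \<subseteq> X"
  shows "continuous_on {0..1} (\<lambda>l. pmf (power_pmf k (mix_pmf l P Q)) z)"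
proof -
  have "continuous_on {0..1} (\<lambda>l. pmf (mix_pmf l P Q) x) \<longleftrightarrow>
      continuous_on {0..1} (\<lambda>l. (1 - l) * pmf P x + l * pmf Q x)" for x
    by (intro continuous_on_cong) (auto simp: pmf_mix_pmf)
  then have 1: "continuous_on {0..1} (\<lambda>l. pmf (mix_pmf l P Q) x)" for x
    by (simp add: continuous_intros)
  have "continuous_on {0..1} (\<lambda>l. prod_list (map (pmf (mix_pmf l P Q)) xs))" for xs
    by (induction xs) (auto intro!: continuous_intros 1)
  then show ?thesis
    unfolding pmf_power_pmf[OF assms(1) set_mix_pmf[OF assms(2,3)]] by (intro continuous_intros)
qed

lemma finite_bitstrings: "finite (bitstrings n)"
  using finite_lists_length_eq[of "UNIV :: bool set" n] by (simp add: bitstrings_def)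

lemma set_power_pmf:
  assumes "set_pmf P \<subseteq> bitstrings n"
  shows "set_pmf (power_pmf k P) \<subseteq> bitstrings (k * n)"
proof -
  have "length (concat xs) = length xs * n" if "set xs \<subseteq> bitstrings n" for xs :: "bool list list"
    using that by (induction xs) (auto simp: bitstrings_def)
  then show ?thesis
    using set_replicate_pmf_subset[OF assms, of k] by (force simp: power_pmf_def bitstrings_def)
qed

lemma continuous_on_tv_power_mix:
  assumes "set_pmf P \<subseteq> bitstrings n" "set_pmf P' \<subseteq> bitstrings n"
    and "set_pmf Q \<subseteq> bitstrings n" "set_pmf Q' \<subseteq> bitstrings n"
  shows "continuous_on {0..1} (\<lambda>l. tv_dist (power_pmf k (mix_pmf l P P')) (power_pmf k (mix_pmf l Q Q')))"
proof -
  note sub = set_power_pmf[OF set_mix_pmf[OF assms(1,2)]] set_power_pmf[OF set_mix_pmf[OF assms(3,4)]]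
  note cont = continuous_on_pmf_power_mix[OF finite_bitstrings assms(1,2)]
    continuous_on_pmf_power_mix[OF finite_bitstrings assms(3,4)]
  show ?thesis
    unfolding tv_dist_eq_sum[OF finite_bitstrings sub]
    by (intro continuous_intros cont)
qed

section \<open>Computational distance\<close>

lemma expectation_of_bool:
  "measure_pmf.expectation P (\<lambda>z. of_bool (A z)) = measure_pmf.prob P {z. A z}"
proof -
  have "(\<lambda>z. of_bool (A z)) = indicat_real {z. A z}" by (auto simp: indicator_def)
  then show ?thesis by simp
qed

lemma comp_dist_alt:
  "comp_dist m t P Q = (SUP A \<in> {A. wf_circuit m A \<and> circuit_size A \<le> t}.
     \<bar>measure_pmf.prob P {z. circuit_value A z} - measure_pmf.prob Q {z. circuit_value A z}\<bar>)"
  by (simp add: comp_dist_def expectation_of_bool)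

lemma comp_dist_ge:
  assumes "wf_circuit m A" "circuit_size A \<le> t"
  shows "\<bar>measure_pmf.prob P {z. circuit_value A z} - measure_pmf.prob Q {z. circuit_value A z}\<bar>
    \<le> comp_dist m t P Q"
  unfolding comp_dist_alt
  by (rule cSUP_upper) (use assms tv_dist_ge in \<open>auto intro!: bdd_aboveI2[where M = "tv_dist P Q"]\<close>)

lemma comp_dist_le:
  assumes "\<And>A. wf_circuit m A \<Longrightarrow> circuit_size A \<le> t \<Longrightarrow>
    \<bar>measure_pmf.prob P {z. circuit_value A z} - measure_pmf.prob Q {z. circuit_value A z}\<bar> \<le> c"
  shows "comp_dist m t P Q \<le> c"
  unfolding comp_dist_alt
proof (rule cSUP_least)
  have "wf_circuit m (Circuit [] (Const True))" "circuit_size (Circuit [] (Const True)) \<le> t"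
    by (auto simp: wf_circuit_def circuit_size_def)
  then show "{A. wf_circuit m A \<and> circuit_size A \<le> t} \<noteq> {}" by blast
qed (use assms in auto)

lemma comp_dist_le_tv_dist: "comp_dist m t P Q \<le> tv_dist P Q"
  by (intro comp_dist_le tv_dist_ge)

lemma comp_dist_nonneg: "0 \<le> comp_dist m t P Q"
proof -
  have "wf_circuit m (Circuit [] (Const True))" "circuit_size (Circuit [] (Const True)) \<le> t"
    by (auto simp: wf_circuit_def circuit_size_def)
  from comp_dist_ge[OF this, of P Q] show ?thesis by linarith
qed

lemma comp_dist_self: "comp_dist m t P P \<le> 0"
  by (rule comp_dist_le) simp

text \<open>Mixing with \<open>D\<close> multiplies the advantage of each circuit by
  \<open>1 - l\<close>.\<close>

lemma comp_dist_mix_le: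
  assumes "set_pmf D \<subseteq> bitstrings n" "set_pmf E \<subseteq> bitstrings n" "0 \<le> l" "l \<le> 1"
  shows "comp_dist m t D (mix_pmf l E D) \<le> comp_dist m t D E"
proof (rule comp_dist_le)
  fix A assume A: "wf_circuit m A" "circuit_size A \<le> t"
  let ?S = "{z. circuit_value A z}"
  have "measure_pmf.prob D ?S - measure_pmf.prob (mix_pmf l E D) ?S
      = (1 - l) * (measure_pmf.prob D ?S - measure_pmf.prob E ?S)"
    unfolding prob_mix_pmf[OF finite_bitstrings assms(2,1,3,4)] by (simp add: algebra_simps)
  then have "\<bar>measure_pmf.prob D ?S - measure_pmf.prob (mix_pmf l E D) ?S\<bar>
      = (1 - l) * \<bar>measure_pmf.prob D ?S - measure_pmf.prob E ?S\<bar>"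
    using assms by (simp add: abs_mult)
  also have "\<dots> \<le> \<bar>measure_pmf.prob D ?S - measure_pmf.prob E ?S\<bar>"
    using assms by (intro mult_left_le_one_le) auto
  also have "\<dots> \<le> comp_dist m t D E" by (rule comp_dist_ge[OF A])
  finally show "\<bar>measure_pmf.prob D ?S - measure_pmf.prob (mix_pmf l E D) ?S\<bar> \<le> comp_dist m t D E" .
qed

text \<open>
  The lower bound on the total variation distance costs nothing: moving from \<open>E\<^sub>b\<close> towards \<open>D\<^sub>b\<close>
  keeps the distributions indistinguishable, and continuity yields any intermediate distance.
\<close>

lemma interpolate:
  assumes D: "set_pmf D0 \<subseteq> bitstrings n" "set_pmf D1 \<subseteq> bitstrings n"
    and E: "set_pmf E0 \<subseteq> bitstrings n" "set_pmf E1 \<subseteq> bitstrings n"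
    and close: "comp_dist n t D0 E0 \<le> \<epsilon>" "comp_dist n t D1 E1 \<le> \<epsilon>"
    and upper: "tv_dist (power_pmf k E0) (power_pmf k E1)
      \<le> comp_dist (k * n) t (power_pmf k D0) (power_pmf k D1) + d"
    and "0 \<le> d"
  obtains F0 F1 where "set_pmf F0 \<subseteq> bitstrings n" "set_pmf F1 \<subseteq> bitstrings n"
    "comp_dist n t D0 F0 \<le> \<epsilon>" "comp_dist n t D1 F1 \<le> \<epsilon>"
    "comp_dist (k * n) t (power_pmf k D0) (power_pmf k D1) - d \<le> tv_dist (power_pmf k F0) (power_pmf k F1)"
    "tv_dist (power_pmf k F0) (power_pmf k F1) \<le> comp_dist (k * n) t (power_pmf k D0) (power_pmf k D1) + d"
    "E0 = D0 \<longrightarrow> F0 = D0"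
proof -
  let ?c = "comp_dist (k * n) t (power_pmf k D0) (power_pmf k D1)"
  let ?f = "\<lambda>l. tv_dist (power_pmf k (mix_pmf l E0 D0)) (power_pmf k (mix_pmf l E1 D1))"
  show thesis
  proof (cases "?c - d \<le> tv_dist (power_pmf k E0) (power_pmf k E1)")
    case True
    then show thesis using that[of E0 E1] assms by simp
  next
    case False
    then have "?f 0 \<le> ?c" using \<open>0 \<le> d\<close> by simp
    \<comment> \<open>At \<open>l = 1\<close> the mixtures are \<open>D0\<close> and
      \<open>D1\<close> themselves, whose computational distance cannot exceed their total variation
      distance. If \<open>E0 = D0\<close>, the mixture of the two remains \<open>D0\<close>.\<close>
    moreover have "?c \<le> ?f 1" by (simp add: comp_dist_le_tv_dist)
    ultimately obtain l where l: "0 \<le> l" "l \<le> 1" "?f l = ?c"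
      using IVT'[of ?f 0 ?c 1] continuous_on_tv_power_mix[OF E(1) D(1) E(2) D(2)] by auto
    show thesis
    proof (rule that)
      show "comp_dist n t D0 (mix_pmf l E0 D0) \<le> \<epsilon>" "comp_dist n t D1 (mix_pmf l E1 D1) \<le> \<epsilon>"
        using comp_dist_mix_le[OF D(1) E(1) l(1,2)] comp_dist_mix_le[OF D(2) E(2) l(1,2)] close
        by (meson order_trans)+
    qed (use l \<open>0 \<le> d\<close> set_mix_pmf[OF E(1) D(1)] set_mix_pmf[OF E(2) D(2)] in simp_all)
  qed
qed

subsection \<open>Energy of a partition into buckets\<close>

locale weight_pair =
  fixes X :: "'a set" and D0 D1 :: "'a \<Rightarrow> real"
  assumes fin: "finite X"
    and D0_nonneg: "\<And>x. 0 \<le> D0 x" and D1_nonneg: "\<And>x. 0 \<le> D1 x"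
    and sum_D0: "sum D0 X = 1" and sum_D1: "sum D1 X = 1"
begin

definition total :: "'a \<Rightarrow> real" where
  "total x = D0 x + D1 x"

definition mass :: "('a \<Rightarrow> real) \<Rightarrow> ('a \<Rightarrow> 'b) \<Rightarrow> 'b \<Rightarrow> real" where
  "mass D L i = (\<Sum>x\<in>{x\<in>X. L x = i}. D x)"

text \<open>Buckets without mass get the junk value \<open>0 / 0 = 0\<close>, which is harmless.\<close>

definition ratio :: "('a \<Rightarrow> 'b) \<Rightarrow> 'b \<Rightarrow> real" where
  "ratio L i = mass D0 L i / mass total L i"

text \<open>The squared norm, in L2 of the measure \<open>total\<close>, of the conditional
  expectation given \<open>L\<close> of the density of \<open>D0\<close> with respect to
  \<open>total\<close>.\<close>

definition energy :: "('a \<Rightarrow> 'b) \<Rightarrow> real" where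
  "energy L = (\<Sum>x\<in>X. total x * (ratio L (L x))\<^sup>2)"

lemma total_nonneg: "0 \<le> total x"
  by (simp add: total_def D0_nonneg D1_nonneg)

lemma sum_total: "sum total X = 2"
  by (simp add: total_def sum.distrib sum_D0 sum_D1)

lemma mass_nonneg: "(\<And>x. 0 \<le> D x) \<Longrightarrow> 0 \<le> mass D L i"
  unfolding mass_def by (rule sum_nonneg) auto

lemma mass_total: "mass total L i = mass D0 L i + mass D1 L i"
  by (simp add: mass_def total_def sum.distrib)

lemma mass_eq_0D:
  assumes "mass D L i = 0" "\<And>x. 0 \<le> D x" "x \<in> X" "L x = i"
  shows "D x = 0"
proof -
  have "\<forall>x\<in>{x\<in>X. L x = i}. D x = 0"
    using assms(1,2) fin unfolding mass_def by (subst (asm) sum_nonneg_eq_0_iff) auto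
  then show ?thesis using assms by auto
qed

lemma sum_buckets: "(\<Sum>x\<in>X. D x * b (L x)) = (\<Sum>i\<in>L ` X. mass D L i * b i)"
  by (subst sum.image_gen[OF fin, of _ L]) (auto simp: mass_def sum_distrib_right intro!: sum.cong)

lemma ratio_mult_mass: "mass total L i * ratio L i = mass D0 L i"
  using mass_nonneg[of D0 L i] mass_nonneg[of D1 L i] D0_nonneg D1_nonneg
  by (auto simp: ratio_def mass_total add_nonneg_eq_0_iff)

lemma ratio_nonneg: "0 \<le> ratio L i"
  unfolding ratio_def by (intro divide_nonneg_nonneg mass_nonneg D0_nonneg total_nonneg)

lemma ratio_le_1: "ratio L i \<le> 1"
  using mass_nonneg[of D0 L i] mass_nonneg[of D1 L i] D0_nonneg D1_nonneg
  by (auto simp: ratio_def mass_total divide_le_eq_1)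

text \<open>The defining property of a conditional expectation: tests that depend on the label alone
  do not notice the averaging.\<close>

lemma calibrated: "(\<Sum>x\<in>X. total x * ratio L (L x) * b (L x)) = (\<Sum>x\<in>X. D0 x * b (L x))"
  using sum_buckets[of total "\<lambda>i. ratio L i * b i" L] sum_buckets[of D0 b L]
  by (simp add: mult.assoc[symmetric] ratio_mult_mass)

lemma energy_eq: "energy L = (\<Sum>x\<in>X. D0 x * ratio L (L x))"
  unfolding energy_def using calibrated[of L "ratio L"] by (simp add: power2_eq_square mult.assoc)

text \<open>The variational formula: \<open>energy\<close> is the maximum of the right-hand side over all \<open>h\<close>.\<close>

lemma energy_ge: "energy L \<ge> 2 * (\<Sum>x\<in>X. D0 x * h (L x)) - (\<Sum>x\<in>X. total x * (h (L x))\<^sup>2)"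
proof -
  have "0 \<le> (\<Sum>x\<in>X. total x * (ratio L (L x) - h (L x))\<^sup>2)"
    by (intro sum_nonneg mult_nonneg_nonneg total_nonneg) auto
  also have "\<dots> = energy L - 2 * (\<Sum>x\<in>X. total x * ratio L (L x) * h (L x))
      + (\<Sum>x\<in>X. total x * (h (L x))\<^sup>2)"
    unfolding energy_def sum_distrib_left sum_subtractf[symmetric] sum.distrib[symmetric]
    by (intro sum.cong) (auto simp: power2_eq_square algebra_simps)
  finally show ?thesis by (simp add: calibrated)
qed

lemma energy_le_1: "energy L \<le> 1"
proof -
  have "energy L \<le> (\<Sum>x\<in>X. D0 x)"
    unfolding energy_eq by (intro sum_mono mult_left_le ratio_le_1 D0_nonneg)
  then show ?thesis by (simp add: sum_D0)
qed

text \<open>The competitor is the constant \<open>1 / 2\<close>, the mean of the density of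
  \<open>D0\<close>. Together with \<open>energy_le_1\<close> it leaves an interval of length
  \<open>1 / 2\<close>, the budget in \<open>real j * G \<le> 1 / 2\<close>.\<close>

lemma energy_ge_half: "energy L \<ge> 1 / 2"
  using energy_ge[of "\<lambda>_. 1/2" L]
  by (simp add: sum_D0 sum_total sum_divide_distrib[symmetric] power2_eq_square)

text \<open>The competitor in the variational formula is the old ratio plus
  \<open>c * a (L x) * (of_bool (f x) - 1 / 2)\<close>. Centring at \<open>1 / 2\<close> does not
  change \<open>\<delta>\<close>, because of \<open>calibrated\<close>, and makes the square of the
  last factor constantly \<open>1 / 4\<close>. The choice \<open>c = \<delta> / U\<close> maximises
  \<open>2 * c * \<delta> - c\<^sup>2 * U\<close>.\<close>

lemma energy_split:
  assumes "(\<Sum>x\<in>X. total x * (a (L x))\<^sup>2) / 4 \<le> U" "0 < U"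
    and \<delta>: "\<delta> = (\<Sum>x\<in>X. (D0 x - total x * ratio L (L x)) * a (L x) * of_bool (f x))"
  shows "energy L + \<delta>\<^sup>2 / U \<le> energy (\<lambda>x. (L x, f x))"
proof -
  define c where "c = \<delta> / U"
  let ?g = "\<lambda>x. ratio L (L x)"
  let ?u = "\<lambda>x. a (L x) * (of_bool (f x) - 1 / 2)"
  have "(\<Sum>x\<in>X. (D0 x - total x * ?g x) * ?u x)
      = \<delta> - ((\<Sum>x\<in>X. D0 x * a (L x)) - (\<Sum>x\<in>X. total x * ?g x * a (L x))) / 2"
    unfolding \<delta> sum_subtractf[symmetric] sum_divide_distrib
    by (intro sum.cong) (auto simp: field_simps)
  then have 1: "(\<Sum>x\<in>X. (D0 x - total x * ?g x) * ?u x) = \<delta>"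
    by (simp add: calibrated)
  have 2: "(\<Sum>x\<in>X. total x * (?u x)\<^sup>2) = (\<Sum>x\<in>X. total x * (a (L x))\<^sup>2) / 4"
    unfolding sum_divide_distrib by (intro sum.cong) (auto simp: power2_eq_square)
  have "energy (\<lambda>x. (L x, f x)) \<ge> 2 * (\<Sum>x\<in>X. D0 x * (?g x + c * ?u x))
      - (\<Sum>x\<in>X. total x * (?g x + c * ?u x)\<^sup>2)"
    using energy_ge[of "\<lambda>(i, b). ratio L i + c * (a i * (of_bool b - 1 / 2))" "\<lambda>x. (L x, f x)"]
    by simp
  also have "2 * (\<Sum>x\<in>X. D0 x * (?g x + c * ?u x)) - (\<Sum>x\<in>X. total x * (?g x + c * ?u x)\<^sup>2)
    = 2 * (\<Sum>x\<in>X. D0 x * ?g x) - energy L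
      + 2 * c * (\<Sum>x\<in>X. (D0 x - total x * ?g x) * ?u x) - c\<^sup>2 * (\<Sum>x\<in>X. total x * (?u x)\<^sup>2)"
    unfolding energy_def sum_distrib_left sum_subtractf[symmetric] sum.distrib[symmetric]
    by (intro sum.cong) (auto simp: power2_eq_square algebra_simps)
  finally have "energy (\<lambda>x. (L x, f x)) \<ge> energy L + 2 * c * \<delta>
      - c\<^sup>2 * ((\<Sum>x\<in>X. total x * (a (L x))\<^sup>2) / 4)"
    unfolding 1 2 by (simp add: energy_eq)
  moreover have "c\<^sup>2 * ((\<Sum>x\<in>X. total x * (a (L x))\<^sup>2) / 4) \<le> c\<^sup>2 * U"
    using assms(1) by (intro mult_left_mono) auto
  moreover have "2 * c * \<delta> - c\<^sup>2 * U = \<delta>\<^sup>2 / U"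
    using assms(2) by (simp add: c_def power2_eq_square field_simps)
  ultimately show ?thesis by linarith
qed

text \<open>The rounded ratio itself serves as the new label, so buckets with nearby ratios merge
  and the labels stay in \<open>{0..m}\<close> after any number of refinements.\<close>

definition coarsen :: "nat \<Rightarrow> ('a \<Rightarrow> 'b) \<Rightarrow> 'b \<Rightarrow> nat" where
  "coarsen m K i = nat \<lfloor>real m * ratio K i\<rfloor>"

lemma coarsen_le: "coarsen m K i \<le> m"
proof -
  have "real m * ratio K i \<le> real m"
    using ratio_le_1[of K i] by (simp add: mult_left_le)
  then show ?thesis unfolding coarsen_def by linarith
qed

text \<open>The rounded ratio is a function of the new label, hence a competitor for the merged
  partition. It is within \<open>1 / m\<close> of the old ratio, and \<open>total\<close> has mass
  2.\<close>

lemma energy_coarsen: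
  assumes "0 < m"
  shows "energy K - 2 / real m ^ 2 \<le> energy (\<lambda>x. coarsen m K (K x))"
proof -
  let ?g = "\<lambda>x. ratio K (K x)"
  define h where "h x = real (coarsen m K (K x)) / real m" for x
  have *: "(?g x - h x)\<^sup>2 \<le> 1 / real m ^ 2" for x
  proof -
    have "0 \<le> real m * ?g x" using ratio_nonneg[of K "K x"] by simp
    then have "real (coarsen m K (K x)) \<le> real m * ?g x" "real m * ?g x \<le> real (coarsen m K (K x)) + 1"
      unfolding coarsen_def by linarith+
    moreover have "real m * h x = real (coarsen m K (K x))"
      using assms by (simp add: h_def)
    ultimately have "0 \<le> real m * (?g x - h x)" "real m * (?g x - h x) \<le> 1"
      by (simp_all add: right_diff_distrib)
    then have "0 \<le> ?g x - h x" "?g x - h x \<le> 1 / real m"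
      using assms by (simp_all add: zero_le_mult_iff pos_le_divide_eq mult.commute)
    then have "(?g x - h x)\<^sup>2 \<le> (1 / real m)\<^sup>2" by (intro power_mono)
    then show ?thesis by (simp add: power_divide)
  qed
  have "(\<Sum>x\<in>X. total x * (?g x - h x)\<^sup>2) \<le> (\<Sum>x\<in>X. total x * (1 / real m ^ 2))"
    by (intro sum_mono mult_left_mono * total_nonneg)
  then have "energy K - 2 / real m ^ 2 \<le> energy K - (\<Sum>x\<in>X. total x * (?g x - h x)\<^sup>2)"
    by (simp add: sum_distrib_right[symmetric] sum_divide_distrib[symmetric] sum_total)
  also have "\<dots> = 2 * (\<Sum>x\<in>X. total x * ?g x * h x) - (\<Sum>x\<in>X. total x * (h x)\<^sup>2)"
    unfolding energy_def sum_distrib_left sum_subtractf[symmetric] sum.distrib[symmetric]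
    by (intro sum.cong) (auto simp: power2_eq_square algebra_simps)
  also have "(\<Sum>x\<in>X. total x * ?g x * h x) = (\<Sum>x\<in>X. D0 x * h x)"
    unfolding h_def by (rule calibrated[of K "\<lambda>i. real (coarsen m K i) / real m"])
  also have "2 * \<dots> - (\<Sum>x\<in>X. total x * (h x)\<^sup>2) \<le> energy (\<lambda>x. coarsen m K (K x))"
    unfolding h_def by (rule energy_ge)
  finally show ?thesis .
qed

section \<open>Two ways to build a pair of weights from a partition\<close>

definition balanced0 :: "('a \<Rightarrow> 'b) \<Rightarrow> 'a \<Rightarrow> real" where
  "balanced0 L x = total x * ratio L (L x)"

definition balanced1 :: "('a \<Rightarrow> 'b) \<Rightarrow> 'a \<Rightarrow> real" where
  "balanced1 L x = total x * (1 - ratio L (L x))"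

lemma balanced_nonneg: "0 \<le> balanced0 L x" "0 \<le> balanced1 L x"
  by (simp_all add: balanced0_def balanced1_def total_nonneg ratio_nonneg ratio_le_1)

lemma balanced0_calibrated: "(\<Sum>x\<in>X. balanced0 L x * b (L x)) = (\<Sum>x\<in>X. D0 x * b (L x))"
  by (simp add: balanced0_def calibrated)

lemma balanced1_calibrated: "(\<Sum>x\<in>X. balanced1 L x * b (L x)) = (\<Sum>x\<in>X. D1 x * b (L x))"
proof -
  have "(\<Sum>x\<in>X. balanced1 L x * b (L x))
     = (\<Sum>x\<in>X. total x * b (L x)) - (\<Sum>x\<in>X. total x * ratio L (L x) * b (L x))"
    unfolding sum_subtractf[symmetric]
    by (intro sum.cong) (auto simp: balanced1_def algebra_simps)
  moreover have "(\<Sum>x\<in>X. total x * b (L x)) = (\<Sum>x\<in>X. D0 x * b (L x)) + (\<Sum>x\<in>X. D1 x * b (L x))"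
    by (simp add: total_def distrib_right sum.distrib)
  ultimately show ?thesis
    using calibrated[of L b] by linarith
qed

text \<open>The likelihood ratio of the pair equals that of its bucket; cross-multiplied so as to
  make sense for buckets of mass zero.\<close>

lemma balanced_proportional:
  "balanced0 L x * mass D1 L (L x) = balanced1 L x * mass D0 L (L x)"
proof (cases "mass total L (L x) = 0")
  case True
  then have "mass D0 L (L x) = 0" "mass D1 L (L x) = 0"
    using mass_nonneg[of D0 L "L x"] mass_nonneg[of D1 L "L x"] D0_nonneg D1_nonneg
    by (auto simp: mass_total)
  then show ?thesis by simp
next
  case False
  then show ?thesis
    by (simp add: balanced0_def balanced1_def ratio_def mass_total field_simps)
qed

text \<open>Both pairs have the sum \<open>total\<close>, so the two errors cancel and it suffices
  to control one of them.\<close>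

lemma balanced_gap:
  "(\<Sum>x\<in>X. D1 x * of_bool (f x)) - (\<Sum>x\<in>X. balanced1 L x * of_bool (f x))
     = - ((\<Sum>x\<in>X. D0 x * of_bool (f x)) - (\<Sum>x\<in>X. balanced0 L x * of_bool (f x)))"
proof -
  have "(\<Sum>x\<in>X. D1 x * of_bool (f x)) + (\<Sum>x\<in>X. D0 x * of_bool (f x))
     = (\<Sum>x\<in>X. balanced1 L x * of_bool (f x)) + (\<Sum>x\<in>X. balanced0 L x * of_bool (f x))"
    unfolding sum.distrib[symmetric]
    by (intro sum.cong) (auto simp: balanced0_def balanced1_def total_def algebra_simps)
  then show ?thesis by linarith
qed

text \<open>\<open>energy_split\<close> with \<open>a = 1\<close>; then \<open>U = 1 / 2\<close> is
  the mass 2 of \<open>total\<close> divided by 4.\<close>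

lemma balanced_gain:
  assumes "\<bar>(\<Sum>x\<in>X. D0 x * of_bool (f x)) - (\<Sum>x\<in>X. balanced0 L x * of_bool (f x))\<bar> > \<epsilon>" "0 < \<epsilon>"
  shows "energy L + 2 * \<epsilon>\<^sup>2 \<le> energy (\<lambda>x. (L x, f x))"
proof -
  define \<delta> where "\<delta> = (\<Sum>x\<in>X. (D0 x - total x * ratio L (L x)) * (\<lambda>_. 1) (L x) * of_bool (f x))"
  have "\<delta> = (\<Sum>x\<in>X. D0 x * of_bool (f x)) - (\<Sum>x\<in>X. balanced0 L x * of_bool (f x))"
    unfolding \<delta>_def sum_subtractf[symmetric] by (simp add: balanced0_def left_diff_distrib)
  then have "\<epsilon>\<^sup>2 \<le> \<delta>\<^sup>2"
    using assms by (auto simp: abs_le_square_iff[symmetric])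
  moreover have "energy L + \<delta>\<^sup>2 / (1 / 2) \<le> energy (\<lambda>x. (L x, f x))"
    by (rule energy_split[OF _ _ \<delta>_def]) (auto simp: sum_total)
  ultimately show ?thesis by simp
qed

text \<open>The buckets that fail this have total \<open>D0\<close>-mass at most
  \<open>\<eta>\<close>, so giving up on them costs at most \<open>k * \<eta>\<close> in the test.
  On the others the reweighting factor is at most \<open>1 / \<eta>\<close>.\<close>

definition good :: "real \<Rightarrow> ('a \<Rightarrow> 'b) \<Rightarrow> 'b \<Rightarrow> bool" where
  "good \<eta> L i \<longleftrightarrow> \<eta> * mass D1 L i \<le> mass D0 L i"

definition reweighted :: "real \<Rightarrow> ('a \<Rightarrow> 'b) \<Rightarrow> 'a \<Rightarrow> real" where
  "reweighted \<eta> L x =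
     (if good \<eta> L (L x) then D0 x * (mass D1 L (L x) / mass D0 L (L x)) else D1 x)"

lemma good_mass_0:
  assumes "good \<eta> L i" "mass D0 L i = 0" "0 < \<eta>"
  shows "mass D1 L i = 0"
  using assms mass_nonneg[of D1 L i] D1_nonneg
  by (auto simp: good_def mult_le_0_iff)

lemma reweighted_nonneg: "0 \<le> reweighted \<eta> L x"
  using mass_nonneg[of D0 L "L x"] mass_nonneg[of D1 L "L x"] D0_nonneg D1_nonneg
  by (auto simp: reweighted_def)

lemma reweighted_proportional:
  assumes "good \<eta> L (L x)" "0 < \<eta>"
  shows "D0 x * mass D1 L (L x) = reweighted \<eta> L x * mass D0 L (L x)"
  using assms good_mass_0[OF assms(1)] by (auto simp: reweighted_def)

text \<open>Change of measure: \<open>D0\<close> multiplied by the ratio of the bucket masses has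
  the bucket masses of \<open>D1\<close>. The premise covers buckets where that ratio is a division
  by zero.\<close>

lemma transfer_mass:
  assumes "\<And>i. mass D0 L i = 0 \<Longrightarrow> mass D1 L i * c i = 0"
  shows "(\<Sum>x\<in>X. D0 x * (mass D1 L (L x) / mass D0 L (L x) * c (L x))) = (\<Sum>x\<in>X. D1 x * c (L x))"
  unfolding sum_buckets[of D1 c L] sum_buckets[of D0 "\<lambda>i. mass D1 L i / mass D0 L i * c i" L]
  using assms by (intro sum.cong) auto

lemma reweighted_calibrated:
  assumes "0 < \<eta>"
  shows "(\<Sum>x\<in>X. reweighted \<eta> L x * b (L x)) = (\<Sum>x\<in>X. D1 x * b (L x))"
proof -
  let ?c = "\<lambda>i. of_bool (good \<eta> L i) * b i"
  have "(\<Sum>x\<in>X. reweighted \<eta> L x * b (L x))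
     = (\<Sum>x\<in>X. D0 x * (mass D1 L (L x) / mass D0 L (L x) * ?c (L x)))
       + (\<Sum>x\<in>X. D1 x * (of_bool (\<not> good \<eta> L (L x)) * b (L x)))"
    unfolding sum.distrib[symmetric] by (intro sum.cong) (auto simp: reweighted_def)
  also have "(\<Sum>x\<in>X. D0 x * (mass D1 L (L x) / mass D0 L (L x) * ?c (L x))) = (\<Sum>x\<in>X. D1 x * ?c (L x))"
    by (rule transfer_mass) (auto dest: good_mass_0 simp: assms)
  also have "\<dots> + (\<Sum>x\<in>X. D1 x * (of_bool (\<not> good \<eta> L (L x)) * b (L x))) = (\<Sum>x\<in>X. D1 x * b (L x))"
    unfolding sum.distrib[symmetric] by (intro sum.cong) auto
  finally show ?thesis .
qed

text \<open>On good buckets of positive \<open>D0\<close>-mass the weight \<open>a\<close> is the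
  inverse of \<open>ratio\<close>; it turns \<open>D0 x - total x * ratio L (L x)\<close> into
  \<open>reweighted \<eta> L x - D1 x\<close>, so \<open>\<delta>\<close> is the negated gap. The
  price is the norm of \<open>a\<close>, of order \<open>1 / \<eta>\<^sup>2\<close>, by which the
  gain is divided.\<close>

lemma reweighted_gain:
  assumes gap: "\<bar>(\<Sum>x\<in>X. D1 x * of_bool (f x)) - (\<Sum>x\<in>X. reweighted \<eta> L x * of_bool (f x))\<bar> > \<epsilon>"
    and "0 < \<epsilon>" "0 < \<eta>"
  shows "energy L + 4 * \<epsilon>\<^sup>2 / (4 + 3 / \<eta> + 1 / \<eta>\<^sup>2) \<le> energy (\<lambda>x. (L x, f x))"
proof -
  define S where "S i \<longleftrightarrow> good \<eta> L i \<and> mass D0 L i \<noteq> 0" for i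
  define t where "t i = mass D1 L i / mass D0 L i" for i
  define a where "a i = of_bool (S i) * (1 + t i)" for i
  have mass_pos: "mass D0 L i \<ge> 0" "mass D1 L i \<ge> 0" for i
    by (auto intro: mass_nonneg D0_nonneg D1_nonneg)
  define \<delta> where "\<delta> = (\<Sum>x\<in>X. (D0 x - total x * ratio L (L x)) * a (L x) * of_bool (f x))"
  have "- \<delta> = (\<Sum>x\<in>X. D1 x * of_bool (f x)) - (\<Sum>x\<in>X. reweighted \<eta> L x * of_bool (f x))"
    unfolding \<delta>_def sum_subtractf[symmetric] sum_negf[symmetric]
  proof (intro sum.cong refl)
    fix x assume x: "x \<in> X"
    have "- ((D0 x - total x * ratio L (L x)) * a (L x)) = D1 x - reweighted \<eta> L x"
    proof (cases "S (L x)")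
      case True
      then have "mass D0 L (L x) > 0" using mass_pos[of "L x"] by (simp add: S_def)
      moreover from this have "mass D0 L (L x) + mass D1 L (L x) > 0" using mass_pos[of "L x"] by simp
      moreover from calculation have "1 + t (L x) = (mass D0 L (L x) + mass D1 L (L x)) / mass D0 L (L x)"
        by (simp add: t_def field_simps)
      ultimately have "ratio L (L x) * a (L x) = 1" "a (L x) = 1 + t (L x)"
        using True by (simp_all add: a_def ratio_def mass_total)
      then have "(D0 x - total x * ratio L (L x)) * a (L x) = D0 x * (1 + t (L x)) - total x"
        by (simp add: left_diff_distrib mult.assoc)
      then show ?thesis using True
        by (simp add: S_def reweighted_def t_def total_def algebra_simps)
    next
      case False
      then have "a (L x) = 0" by (simp add: a_def)
      moreover have "D1 x = reweighted \<eta> L x"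
      proof (cases "good \<eta> L (L x)")
        case True
        then have 0: "mass D0 L (L x) = 0" using False by (simp add: S_def)
        then have "mass D1 L (L x) = 0" by (rule good_mass_0[OF True _ assms(3)])
        then have "D1 x = 0" by (rule mass_eq_0D[OF _ D1_nonneg x refl])
        with 0 show ?thesis by (simp add: reweighted_def)
      qed (simp add: reweighted_def)
      ultimately show ?thesis by simp
    qed
    then show "- ((D0 x - total x * ratio L (L x)) * a (L x) * of_bool (f x))
        = D1 x * of_bool (f x) - reweighted \<eta> L x * of_bool (f x)"
      by (simp add: left_diff_distrib[symmetric])
  qed
  then have \<delta>: "\<epsilon>\<^sup>2 \<le> \<delta>\<^sup>2"
    using gap assms(2) by (auto simp: abs_le_square_iff[symmetric])
  define B where "B = 4 + 3 / \<eta> + 1 / \<eta>\<^sup>2"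
  have B: "B > 0" using assms unfolding B_def by (intro add_pos_pos) auto
  have t_le: "t i \<le> 1 / \<eta>" "0 \<le> t i" if "S i" for i
  proof -
    have "mass D0 L i > 0" using that mass_pos[of i] by (simp add: S_def)
    then show "t i \<le> 1 / \<eta>" "0 \<le> t i" using that assms mass_pos[of i]
      by (auto simp: S_def good_def t_def field_simps)
  qed
  \<comment> \<open>A factor \<open>t\<close> under \<open>D0\<close> is traded for the measure
    \<open>D1\<close>. Bounding every \<open>t\<close> by \<open>1 / \<eta>\<close> instead would
    give \<open>2 * (1 + 1 / \<eta>)\<^sup>2\<close>, too much for \<open>gain_bound\<close> when
    \<open>\<epsilon>\<close> is near \<open>1 / 2\<close>.\<close>
  have tr: "(\<Sum>x\<in>X. D0 x * (t (L x) * (of_bool (S (L x)) * c (L x))))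
      = (\<Sum>x\<in>X. D1 x * (of_bool (S (L x)) * c (L x)))" for c
    unfolding t_def by (rule transfer_mass) (auto simp: S_def)
  have "(\<Sum>x\<in>X. total x * (a (L x))\<^sup>2)
    = (\<Sum>x\<in>X. D0 x * of_bool (S (L x)))
      + (\<Sum>x\<in>X. D0 x * (t (L x) * (of_bool (S (L x)) * (2 + t (L x)))))
      + (\<Sum>x\<in>X. D1 x * (of_bool (S (L x)) * (1 + 2 * t (L x) + (t (L x))\<^sup>2)))"
    unfolding sum.distrib[symmetric]
    by (intro sum.cong) (auto simp: a_def total_def power2_eq_square algebra_simps)
  also have "\<dots> = (\<Sum>x\<in>X. D0 x * of_bool (S (L x)))
      + (\<Sum>x\<in>X. D1 x * (of_bool (S (L x)) * (3 + 3 * t (L x) + (t (L x))\<^sup>2)))"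
    unfolding tr[of "\<lambda>i. 2 + t i"] add.assoc sum.distrib[symmetric]
    by (intro arg_cong2[where f="(+)"] refl sum.cong) (auto simp: algebra_simps)
  also have "\<dots> \<le> (\<Sum>x\<in>X. D0 x * 1) + (\<Sum>x\<in>X. D1 x * (3 + 3 / \<eta> + 1 / \<eta>\<^sup>2))"
  proof (intro add_mono sum_mono mult_left_mono D0_nonneg D1_nonneg)
    fix x
    show "of_bool (S (L x)) * (3 + 3 * t (L x) + (t (L x))\<^sup>2) \<le> 3 + 3 / \<eta> + 1 / \<eta>\<^sup>2"
    proof (cases "S (L x)")
      case True
      have "(t (L x))\<^sup>2 \<le> (1 / \<eta>)\<^sup>2" by (intro power_mono t_le True)
      then show ?thesis using True t_le(1)[OF True] by (simp add: power_divide)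
    next
      case False
      have "0 \<le> 3 / \<eta>" "0 \<le> 1 / \<eta>\<^sup>2" using assms by auto
      then show ?thesis using False by simp
    qed
  qed auto
  also have "\<dots> = B"
    by (simp add: sum_distrib_right[symmetric] sum_D0 sum_D1 B_def)
  finally have "(\<Sum>x\<in>X. total x * (a (L x))\<^sup>2) / 4 \<le> B / 4" by simp
  from energy_split[OF this _ \<delta>_def] B have "energy L + \<delta>\<^sup>2 / (B / 4) \<le> energy (\<lambda>x. (L x, f x))"
    by simp
  moreover have "4 * \<epsilon>\<^sup>2 / B \<le> \<delta>\<^sup>2 / (B / 4)"
    using \<delta> B by (simp add: divide_right_mono)
  ultimately show ?thesis unfolding B_def by linarith
qed

end

subsection \<open>Simulating a pair of distributions\<close>

lemma exists_pmf:
  assumes "finite X" "\<And>x. 0 \<le> w x" "sum w X = 1"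
  obtains P where "set_pmf P \<subseteq> X" "\<And>x. x \<in> X \<Longrightarrow> pmf P x = w x"
proof -
  let ?f = "\<lambda>x. if x \<in> X then w x else 0"
  have "(\<integral>\<^sup>+x. ennreal (?f x) \<partial>count_space UNIV) = (\<Sum>x\<in>X. ennreal (?f x))"
    using assms(1) by (intro nn_integral_count_space') auto
  also have "\<dots> = ennreal (sum w X)"
    using assms(2) by (simp add: sum_ennreal)
  finally have *: "pmf (embed_pmf ?f) x = ?f x" for x
    using assms by (intro pmf_embed_pmf) auto
  show thesis
  proof (rule that)
    show "set_pmf (embed_pmf ?f) \<subseteq> X" by (auto simp: set_pmf_eq * split: if_splits)
  qed (simp add: *)
qed

lemma concat_blocks:
  assumes "\<And>x. x \<in> set xs \<Longrightarrow> length x = n"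
  shows "map (\<lambda>i. take n (drop (i * n) (concat xs))) [0..<length xs] = xs"
  using assms
proof (induction xs)
  case (Cons x xs)
  have "map (\<lambda>i. take n (drop (i * n) (concat (x # xs)))) [0..<length (x # xs)]
      = take n (concat (x # xs)) # map (\<lambda>i. take n (drop (Suc i * n) (concat (x # xs)))) [0..<length xs]"
    by (simp only: length_Cons map_upt_Suc) simp
  then show ?case using Cons by simp
qed simp

locale bitstring_pair =
  fixes n :: nat and D0 D1 :: "bool list pmf"
  assumes D0: "set_pmf D0 \<subseteq> bitstrings n" and D1: "set_pmf D1 \<subseteq> bitstrings n"
begin

sublocale weight_pair "bitstrings n" "pmf D0" "pmf D1"
  by standard (auto simp: finite_bitstrings sum_pmf_eq_1 D0 D1)

text \<open>The returned partition is one that no circuit of size \<open>s + k * t + P\<close>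
  refines profitably. A refinement must gain \<open>2 / m\<^sup>2\<close> beyond \<open>G\<close> to
  pay for the merging that follows it, so each completed step nets \<open>G\<close>.\<close>

lemma energy_increment:
  fixes m s k P :: nat and G :: real
  assumes "0 < m" "0 < G"
  defines "B \<equiv> 4 * Suc m + 1"
  obtains j t L where "real j * G \<le> 1 / 2" "realizable n t (onehot (Suc m) L)" "\<And>z. L z \<le> m"
    "s + k * t + P + B \<le> (k + 1) ^ j * (s + P + B)"
    "\<And>f. realizable n (s + k * t + P) {f} \<Longrightarrow> energy (\<lambda>x. (L x, f x)) < energy L + G + 2 / real m ^ 2"
proof (rule ccontr)
  note found = that
  assume *: "\<not> thesis"
  \<comment> \<open>If every partition could still be refined profitably, there would be one for
    each \<open>j\<close>, with energy growing linearly in \<open>j\<close>.\<close>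
  have "\<exists>t L. realizable n t (onehot (Suc m) L) \<and> (\<forall>z. L z \<le> m)
    \<and> s + k * t + P + B \<le> (k + 1) ^ j * (s + P + B) \<and> 1 / 2 + real j * G \<le> energy L" for j
  proof (induction j)
    case 0
    have "realizable n 0 (onehot (Suc m) (\<lambda>_. 0))"
      by (rule realizable_mono[OF realizable_consts]) (auto simp: onehot_def)
    then show ?case
      using energy_ge_half by (intro exI[of _ 0] exI[of _ "\<lambda>_. 0"]) auto
  next
    case (Suc j)
    then obtain t L where L: "realizable n t (onehot (Suc m) L)" "\<And>z. L z \<le> m"
      "s + k * t + P + B \<le> (k + 1) ^ j * (s + P + B)" "1 / 2 + real j * G \<le> energy L"
      by blast
    let ?s = "s + k * t + P"
    have "real j * G \<le> 1 / 2" using L(4) energy_le_1[of L] by linarith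
    have "\<exists>f. realizable n ?s {f} \<and> energy L + G + 2 / real m ^ 2 \<le> energy (\<lambda>x. (L x, f x))"
    proof (rule ccontr)
      assume "\<not> ?thesis"
      then have "energy (\<lambda>x. (L x, f x)) < energy L + G + 2 / real m ^ 2" if "realizable n ?s {f}" for f
        using that by (meson not_le)
      from found[OF \<open>real j * G \<le> 1 / 2\<close> L(1-3) this] * show False by blast
    qed
    then obtain f where f: "realizable n ?s {f}"
        "energy L + G + 2 / real m ^ 2 \<le> energy (\<lambda>x. (L x, f x))"
      by blast
    define K where "K = (\<lambda>x. (L x, f x))"
    define \<delta> where "\<delta> u i = coarsen m K (i, u = (1::nat))" for u i
    let ?\<sigma> = "\<lambda>z. of_bool (f z) :: nat"
    have "realizable n (t + ?s) (onehot (Suc m) L \<union> {f})"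
      by (rule realizable_union_same[OF L(1) f(1)])
    \<comment> \<open>Coding the bit \<open>f z\<close> in unary needs a wire for its negation. This
      is the single gate in \<open>B\<close>; the other \<open>4 * Suc m\<close> are the table for
      two states and \<open>Suc m\<close> labels.\<close>
    then have "realizable n (Suc (t + ?s)) (insert (\<lambda>z. \<not> f z) (onehot (Suc m) L \<union> {f}))"
      by (rule realizable_neg) simp
    then have "realizable n (Suc (t + ?s)) (onehot 2 ?\<sigma> \<union> onehot (Suc m) L)"
      by (rule realizable_mono[OF _ order.refl]) (auto simp: onehot_def numeral_2_eq_2 less_Suc_eq)
    then have 1: "realizable n (Suc (t + ?s) + 2 * (2 * Suc m)) (onehot (Suc m) (\<lambda>z. \<delta> (?\<sigma> z) (L z)))"
      by (rule realizable_onehot_combine[OF _ Un_upper1 Un_upper2])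
        (use L(2) in \<open>auto simp: less_Suc_eq_le\<close>)
    have 2: "\<delta> (?\<sigma> z) (L z) = coarsen m K (K z)" for z
      by (simp add: \<delta>_def K_def)
    have 3: "Suc (t + ?s) + 2 * (2 * Suc m) = t + ?s + B" by (simp add: B_def)
    have "realizable n (t + ?s + B) (onehot (Suc m) (\<lambda>z. coarsen m K (K z)))"
      using 1 unfolding 2 3 .
    \<comment> \<open>Adding \<open>B\<close> to the size makes its recursion exactly
      geometric.\<close>
    moreover have "s + k * (t + ?s + B) + P + B = (k + 1) * (?s + B)"
      by (simp add: algebra_simps)
    then have "s + k * (t + ?s + B) + P + B \<le> (k + 1) ^ Suc j * (s + P + B)"
      using mult_le_mono2[OF L(3), of "k + 1"] by (simp only: power_Suc mult.assoc)
    moreover have "energy K - 2 / real m ^ 2 \<le> energy (\<lambda>x. coarsen m K (K x))"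
      by (rule energy_coarsen[OF assms(1)])
    then have "1 / 2 + real (Suc j) * G \<le> energy (\<lambda>x. coarsen m K (K x))"
      using f(2) L(4) by (simp add: K_def distrib_right)
    ultimately show ?case
      by (intro exI[of _ "t + ?s + B"] exI[of _ "\<lambda>z. coarsen m K (K z)"] conjI allI coarsen_le)
  qed note increase = this
  obtain j :: nat where "1 < real j * G"
    using reals_Archimedean3[OF \<open>0 < G\<close>] by blast
  moreover obtain L :: "bool list \<Rightarrow> nat" where "1 / 2 + real j * G \<le> energy L"
    using increase[of j] by blast
  ultimately show False
    using energy_le_1[of L] by linarith
qed

text \<open>For a good bucket the set contains \<open>0\<close>; the weight of any other bucket is irrelevant.\<close>

definition weight :: "real \<Rightarrow> real \<Rightarrow> nat \<Rightarrow> (bool list \<Rightarrow> nat) \<Rightarrow> nat \<Rightarrow> nat" where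
  "weight \<beta> \<eta> \<tau> L i = Max {h. h \<le> \<tau> \<and> \<beta> ^ h * \<eta> * mass (pmf D1) L i \<le> mass (pmf D0) L i}"

lemma
  assumes "good \<eta> L i"
  shows weight_lower: "\<beta> ^ weight \<beta> \<eta> \<tau> L i * \<eta> * mass (pmf D1) L i \<le> mass (pmf D0) L i"
    and weight_upper: "weight \<beta> \<eta> \<tau> L i < \<tau> \<Longrightarrow>
      mass (pmf D0) L i < \<beta> ^ Suc (weight \<beta> \<eta> \<tau> L i) * \<eta> * mass (pmf D1) L i"
proof -
  let ?S = "{h. h \<le> \<tau> \<and> \<beta> ^ h * \<eta> * mass (pmf D1) L i \<le> mass (pmf D0) L i}"
  have S: "finite ?S" "?S \<noteq> {}"
    using assms by (auto simp: good_def intro!: exI[of _ 0])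
  from Max_in[OF S] show
    "\<beta> ^ weight \<beta> \<eta> \<tau> L i * \<eta> * mass (pmf D1) L i \<le> mass (pmf D0) L i"
    by (auto simp: weight_def)
  assume less: "weight \<beta> \<eta> \<tau> L i < \<tau>"
  have "Suc (weight \<beta> \<eta> \<tau> L i) \<notin> ?S"
    using Max_ge[OF S(1), of "Suc (weight \<beta> \<eta> \<tau> L i)"] unfolding weight_def by fastforce
  then show "mass (pmf D0) L i < \<beta> ^ Suc (weight \<beta> \<eta> \<tau> L i) * \<eta> * mass (pmf D1) L i"
    using less by auto
qed

text \<open>State \<open>Suc \<tau>\<close> records that a point of a bad bucket has been read.\<close>

definition step :: "real \<Rightarrow> real \<Rightarrow> nat \<Rightarrow> (bool list \<Rightarrow> nat) \<Rightarrow> nat \<Rightarrow> nat \<Rightarrow> nat" where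
  "step \<beta> \<eta> \<tau> L u i =
     (if u = Suc \<tau> \<or> \<not> good \<eta> L i then Suc \<tau> else min \<tau> (u + weight \<beta> \<eta> \<tau> L i))"

lemma foldl_step:
  "foldl (step \<beta> \<eta> \<tau> L) 0 is =
     (if \<forall>i\<in>set is. good \<eta> L i then min \<tau> (sum_list (map (weight \<beta> \<eta> \<tau> L) is)) else Suc \<tau>)"
  by (induction "is" rule: rev_induct) (auto simp: step_def)

text \<open>Sums are truncated at \<open>\<tau>\<close>, so \<open>\<tau> + 2\<close> states
  suffice, the last one being the reject state; acceptance means ending in state
  \<open>\<tau>\<close> exactly.\<close>

lemma threshold_circuit:
  fixes \<beta> \<eta> :: real
  assumes L: "realizable n t (onehot (Suc m) L)" "\<And>z. L z \<le> m"
    and s: "k * t + 2 * k * (\<tau> + 2) * Suc m \<le> s"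
  defines "T \<equiv> {xs. set xs \<subseteq> {x. good \<eta> L (L x)} \<and> \<tau> \<le> sum_list (map (\<lambda>x. weight \<beta> \<eta> \<tau> L (L x)) xs)}"
  obtains A where "wf_circuit (k * n) A" "circuit_size A \<le> s"
    "\<And>D. set_pmf D \<subseteq> bitstrings n \<Longrightarrow>
      measure_pmf.prob (power_pmf k D) {z. circuit_value A z} = measure_pmf.prob (replicate_pmf k D) T"
proof -
  define F where "F z = foldl (step \<beta> \<eta> \<tau> L) 0 (map (\<lambda>i. L (take n (drop (i * n) z))) [0..<k])" for z
  have "realizable (k * n) (k * (t + 2 * ((\<tau> + 2) * Suc m))) (onehot (\<tau> + 2) F)"
    unfolding F_def
    by (rule realizable_automaton[OF L(1)]) (use L(2) in \<open>auto simp: less_Suc_eq_le step_def\<close>)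
  then have "realizable (k * n) s {\<lambda>z. F z = \<tau>}"
    by (rule realizable_mono) (use s in \<open>auto simp: onehot_def algebra_simps\<close>)
  then obtain A where A: "wf_circuit (k * n) A" "circuit_size A \<le> s"
      "\<And>z. z \<in> bitstrings (k * n) \<Longrightarrow> circuit_value A z \<longleftrightarrow> F z = \<tau>"
    by (auto simp: realizable_iff_circuit)
  have "measure_pmf.prob (power_pmf k D) {z. circuit_value A z} = measure_pmf.prob (replicate_pmf k D) T"
    if D: "set_pmf D \<subseteq> bitstrings n" for D
  proof -
    have "concat xs \<in> {z. circuit_value A z} \<longleftrightarrow> xs \<in> T" if xs: "xs \<in> set_pmf (replicate_pmf k D)" for xs
    proof -
      have len: "length xs = k" and n: "\<And>x. x \<in> set xs \<Longrightarrow> length x = n"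
        using xs D by (auto simp: set_replicate_pmf bitstrings_def)
      have "concat xs \<in> set_pmf (power_pmf k D)" using xs by (auto simp: power_pmf_def)
      then have "concat xs \<in> bitstrings (k * n)" using set_power_pmf[OF D] by blast
      moreover have "map (\<lambda>i. L (take n (drop (i * n) (concat xs)))) [0..<k] = map L xs"
        using arg_cong[OF concat_blocks[OF n], of xs "map L"] by (simp add: len comp_def)
      then have "F (concat xs) = \<tau> \<longleftrightarrow> xs \<in> T"
        unfolding F_def by (auto simp: foldl_step T_def comp_def min_def)
      ultimately show ?thesis by (simp add: A(3))
    qed
    then show ?thesis
      unfolding power_pmf_def measure_map_pmf
      by (intro measure_pmf.finite_measure_eq_AE) (auto simp: AE_measure_pmf_iff)
  qed
  with A show thesis by (intro that)
qed

lemma pmf_map_eq_mass: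
  "set_pmf D \<subseteq> bitstrings n \<Longrightarrow> pmf (map_pmf L D) i = mass (pmf D) L i"
  unfolding pmf_map mass_def
  by (auto simp: prob_eq_sum[OF finite_bitstrings] finite_bitstrings intro!: sum.mono_neutral_cong_right)

lemma tv_dist_le_comp_dist:
  assumes L: "realizable n t (onehot (Suc m) L)" "\<And>z. L z \<le> m"
    and s: "k * t + 2 * k * (\<tau> + 2) * Suc m \<le> s"
    and E: "set_pmf E0 \<subseteq> bitstrings n" "set_pmf E1 \<subseteq> bitstrings n"
    and map: "map_pmf L E0 = map_pmf L D0" "map_pmf L E1 = map_pmf L D1"
    and proportional: "\<And>x. x \<in> bitstrings n \<Longrightarrow> good \<eta> L (L x) \<Longrightarrow>
      pmf E0 x * mass (pmf D1) L (L x) = pmf E1 x * mass (pmf D0) L (L x)"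
    and \<beta>: "1 \<le> \<beta>" and \<eta>: "0 < \<eta>"
    and \<tau>: "1 \<le> \<beta> ^ \<tau> * \<eta> ^ k" "\<And>j. j < \<tau> \<Longrightarrow> \<beta> ^ j * \<eta> ^ k \<le> 1"
  shows "tv_dist (power_pmf k E0) (power_pmf k E1)
    \<le> comp_dist (k * n) s (power_pmf k D0) (power_pmf k D1) + k * (\<eta> + (\<beta> - 1))"
proof -
  let ?p = "mass (pmf D0) L" and ?q = "mass (pmf D1) L" and ?w = "weight \<beta> \<eta> \<tau> L"
  define G where "G = {x. good \<eta> L (L x)}"
  define T where "T = {xs. set xs \<subseteq> G \<and> \<tau> \<le> sum_list (map (\<lambda>x. ?w (L x)) xs)}"
  have pq: "0 \<le> ?p i" "0 \<le> ?q i" for i by (auto intro: mass_nonneg)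
  have lower: "\<beta> ^ ?w (L x) * \<eta> * pmf E1 x \<le> pmf E0 x" if x: "x \<in> bitstrings n" "x \<in> G" for x
  proof (cases "?p (L x) = 0")
    \<comment> \<open>Cancelling the \<open>D0\<close>-mass is impossible here, but a good bucket
      without \<open>D0\<close>-mass has no \<open>D1\<close>-mass either, and \<open>E1\<close>
      agrees with \<open>D1\<close> on buckets.\<close>
    case True
    then have "?q (L x) = 0" using good_mass_0 x \<eta> by (auto simp: G_def)
    then have "pmf (map_pmf L E1) (L x) = 0" by (simp add: map pmf_map_eq_mass D1)
    then have "pmf E1 x = 0" by (auto simp: pmf_eq_0_set_pmf)
    then show ?thesis by simp
  next
    case False
    then have p: "?p (L x) > 0" using pq[of "L x"] by simp
    have "\<beta> ^ ?w (L x) * \<eta> * pmf E1 x * ?p (L x) = pmf E0 x * (\<beta> ^ ?w (L x) * \<eta> * ?q (L x))"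
      using proportional[of x] x by (simp add: G_def)
    also have "\<dots> \<le> pmf E0 x * ?p (L x)"
      using weight_lower x by (intro mult_left_mono) (auto simp: G_def)
    finally show ?thesis using p by simp
  qed
  have upper: "pmf E0 x \<le> \<beta> ^ Suc (?w (L x)) * \<eta> * pmf E1 x"
    if x: "x \<in> bitstrings n" "x \<in> G" "?w (L x) < \<tau>" for x
  proof -
    have less: "?p (L x) < \<beta> ^ Suc (?w (L x)) * \<eta> * ?q (L x)"
      using weight_upper x by (auto simp: G_def)
    have q: "?q (L x) > 0"
    proof (rule ccontr)
      assume "\<not> ?q (L x) > 0"
      then have "?q (L x) = 0" using pq(2)[of "L x"] by linarith
      then show False using less pq(1)[of "L x"] by simp
    qed
    have "pmf E0 x * ?q (L x) = pmf E1 x * ?p (L x)" using proportional x by (simp add: G_def)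
    also have "\<dots> \<le> pmf E1 x * (\<beta> ^ Suc (?w (L x)) * \<eta> * ?q (L x))"
      using less by (intro mult_left_mono) auto
    also have "\<dots> = (\<beta> ^ Suc (?w (L x)) * \<eta> * pmf E1 x) * ?q (L x)" by (simp add: ac_simps)
    finally show ?thesis using q by (simp only: mult_le_cancel_right_pos)
  qed
  obtain A where A: "wf_circuit (k * n) A" "circuit_size A \<le> s"
    "\<And>D. set_pmf D \<subseteq> bitstrings n \<Longrightarrow>
      measure_pmf.prob (power_pmf k D) {z. circuit_value A z} = measure_pmf.prob (replicate_pmf k D) T"
    using threshold_circuit[OF L s] unfolding T_def G_def by blast
  \<comment> \<open>Membership in \<open>T\<close> depends on the labels only, and these have the
    same law under both distributions.\<close>
  have labels: "measure_pmf.prob (replicate_pmf k E) T = measure_pmf.prob (replicate_pmf k D) T"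
    if "map_pmf L E = map_pmf L D" for E D :: "bool list pmf"
  proof -
    define T' where "T' = {is. (\<forall>i\<in>set is. good \<eta> L i) \<and> \<tau> \<le> sum_list (map ?w is)}"
    have "T = map L -` T'" by (auto simp: T_def T'_def G_def comp_def)
    then have "measure_pmf.prob (replicate_pmf k E) T = measure_pmf.prob (replicate_pmf k (map_pmf L E)) T'" for E
      by (simp add: map_replicate_pmf[symmetric])
    then show ?thesis by (simp add: that)
  qed
  \<comment> \<open>\<open>E0\<close> and \<open>D0\<close> agree on the bad buckets; each has
    \<open>D0\<close>-mass below \<open>\<eta>\<close> times its \<open>D1\<close>-mass, and the
    \<open>D1\<close>-masses sum to 1.\<close>
  have bad: "measure_pmf.prob E0 (- G) \<le> \<eta>"
  proof -
    define b where "b i = (of_bool (\<not> good \<eta> L i) :: real)" for i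
    have "- G = L -` {i. \<not> good \<eta> L i}" by (auto simp: G_def)
    then have "measure_pmf.prob E0 (- G) = measure_pmf.prob (map_pmf L E0) {i. \<not> good \<eta> L i}" by simp
    also have "\<dots> = (\<Sum>x\<in>bitstrings n. pmf D0 x * b (L x))"
      by (simp add: map prob_eq_sum[OF finite_bitstrings D0] b_def)
    also have "\<dots> \<le> (\<Sum>i\<in>L ` bitstrings n. \<eta> * (?q i * b i))"
      unfolding sum_buckets by (intro sum_mono) (auto simp: b_def good_def)
    also have "\<dots> = \<eta> * (\<Sum>x\<in>bitstrings n. pmf D1 x * b (L x))"
      unfolding sum_buckets by (simp add: sum_distrib_left)
    also have "\<dots> \<le> \<eta> * (\<Sum>x\<in>bitstrings n. pmf D1 x)"
      using \<eta> by (intro mult_left_mono sum_mono) (auto simp: b_def)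
    finally show ?thesis by (simp add: sum_D1)
  qed
  have "tv_dist (power_pmf k E0) (power_pmf k E1) \<le> tv_dist (replicate_pmf k E0) (replicate_pmf k E1)"
    unfolding power_pmf_def by (rule tv_dist_map_le)
  also have "\<dots> \<le> measure_pmf.prob (replicate_pmf k E0) T - measure_pmf.prob (replicate_pmf k E1) T
      + k * (measure_pmf.prob E0 (- G) + (\<beta> - 1))"
    unfolding T_def
    by (rule tv_dist_threshold_test[OF finite_bitstrings E \<beta> \<eta> \<tau>]) (auto intro: lower upper simp del: power_Suc)
  also have "measure_pmf.prob (replicate_pmf k E0) T - measure_pmf.prob (replicate_pmf k E1) T
      = measure_pmf.prob (power_pmf k D0) {z. circuit_value A z} - measure_pmf.prob (power_pmf k D1) {z. circuit_value A z}"
    by (simp add: A(3) D0 D1 labels[OF map(1)] labels[OF map(2)])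
  also have "\<dots> \<le> comp_dist (k * n) s (power_pmf k D0) (power_pmf k D1)"
    using comp_dist_ge[OF A(1,2), of "power_pmf k D0" "power_pmf k D1"] by linarith
  also have "k * (measure_pmf.prob E0 (- G) + (\<beta> - 1)) \<le> k * (\<eta> + (\<beta> - 1))"
    using bad by (intro mult_left_mono) auto
  finally show ?thesis by simp
qed


section \<open>From a partition to a pair of distributions that fools circuits\<close>

lemma prob_eq_sum_bitstrings:
  "set_pmf E \<subseteq> bitstrings n \<Longrightarrow>
    measure_pmf.prob E {z. f z} = (\<Sum>x\<in>bitstrings n. pmf E x * of_bool (f x))"
  by (simp add: prob_eq_sum[OF finite_bitstrings])

lemma map_pmf_eqI:
  assumes "set_pmf E \<subseteq> bitstrings n" "set_pmf D \<subseteq> bitstrings n"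
    and "\<And>b. (\<Sum>x\<in>bitstrings n. pmf E x * b (L x)) = (\<Sum>x\<in>bitstrings n. pmf D x * b (L x) :: real)"
  shows "map_pmf L E = map_pmf L D"
proof (rule pmf_eqI)
  fix i
  show "pmf (map_pmf L E) i = pmf (map_pmf L D) i"
    using assms(3)[of "\<lambda>j. of_bool (j = i)"]
    by (simp add: pmf_map prob_eq_sum[OF finite_bitstrings assms(1)] prob_eq_sum[OF finite_bitstrings assms(2)])
qed

text \<open>The common interface of both constructions, so that the size argument is made once. The
  last clause is the energy gain in contrapositive form: tests whose refinement gains less than
  \<open>g\<close> are fooled.\<close>

definition simulates :: "real \<Rightarrow> real \<Rightarrow> real \<Rightarrow> (bool list \<Rightarrow> nat) \<Rightarrow> bool list pmf \<Rightarrow> bool list pmf \<Rightarrow> bool" where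
  "simulates \<epsilon> \<eta> g L E0 E1 \<longleftrightarrow>
     set_pmf E0 \<subseteq> bitstrings n \<and> set_pmf E1 \<subseteq> bitstrings n \<and>
     map_pmf L E0 = map_pmf L D0 \<and> map_pmf L E1 = map_pmf L D1 \<and>
     (\<forall>x\<in>bitstrings n. good \<eta> L (L x) \<longrightarrow>
        pmf E0 x * mass (pmf D1) L (L x) = pmf E1 x * mass (pmf D0) L (L x)) \<and>
     (\<forall>f. energy (\<lambda>x. (L x, f x)) < energy L + g \<longrightarrow>
        \<bar>measure_pmf.prob D0 {z. f z} - measure_pmf.prob E0 {z. f z}\<bar> \<le> \<epsilon> \<and>
        \<bar>measure_pmf.prob D1 {z. f z} - measure_pmf.prob E1 {z. f z}\<bar> \<le> \<epsilon>)"

lemma simulates_balanced: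
  assumes "0 < \<epsilon>" "g \<le> 2 * \<epsilon>\<^sup>2"
  obtains E0 E1 where "simulates \<epsilon> \<eta> g L E0 E1"
proof -
  have "sum (balanced0 L) (bitstrings n) = 1" "sum (balanced1 L) (bitstrings n) = 1"
    using balanced0_calibrated[of L "\<lambda>_. 1"] balanced1_calibrated[of L "\<lambda>_. 1"]
    by (simp_all add: sum_D0 sum_D1)
  then obtain E0 E1
    where E0: "set_pmf E0 \<subseteq> bitstrings n" "\<And>x. x \<in> bitstrings n \<Longrightarrow> pmf E0 x = balanced0 L x"
      and E1: "set_pmf E1 \<subseteq> bitstrings n" "\<And>x. x \<in> bitstrings n \<Longrightarrow> pmf E1 x = balanced1 L x"
    using exists_pmf[OF finite_bitstrings, of "balanced0 L"] exists_pmf[OF finite_bitstrings, of "balanced1 L"]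
      balanced_nonneg by metis
  have "map_pmf L E0 = map_pmf L D0" "map_pmf L E1 = map_pmf L D1"
    using E0 E1 by (auto intro!: map_pmf_eqI D0 D1 simp: balanced0_calibrated balanced1_calibrated cong: sum.cong)
  moreover have "\<bar>measure_pmf.prob D0 {z. f z} - measure_pmf.prob E0 {z. f z}\<bar> \<le> \<epsilon> \<and>
        \<bar>measure_pmf.prob D1 {z. f z} - measure_pmf.prob E1 {z. f z}\<bar> \<le> \<epsilon>"
    if "energy (\<lambda>x. (L x, f x)) < energy L + g" for f
  proof -
    have "\<bar>(\<Sum>x\<in>bitstrings n. pmf D0 x * of_bool (f x)) - (\<Sum>x\<in>bitstrings n. balanced0 L x * of_bool (f x))\<bar> \<le> \<epsilon>"
      using balanced_gain[of \<epsilon> f L] that assms by argo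
    then show ?thesis
      using balanced_gap[of f L] by (simp add: prob_eq_sum_bitstrings D0 D1 E0 E1 cong: sum.cong)
  qed
  ultimately have "simulates \<epsilon> \<eta> g L E0 E1"
    unfolding simulates_def using E0 E1 balanced_proportional[of L] by simp
  then show thesis by (rule that)
qed

lemma simulates_reweighted:
  assumes "0 < \<epsilon>" "0 < \<eta>" "g \<le> 4 * \<epsilon>\<^sup>2 / (4 + 3 / \<eta> + 1 / \<eta>\<^sup>2)"
  obtains E1 where "simulates \<epsilon> \<eta> g L D0 E1"
proof -
  have "sum (reweighted \<eta> L) (bitstrings n) = 1"
    using reweighted_calibrated[OF assms(2), of L "\<lambda>_. 1"] by (simp add: sum_D1)
  then obtain E1
    where E1: "set_pmf E1 \<subseteq> bitstrings n" "\<And>x. x \<in> bitstrings n \<Longrightarrow> pmf E1 x = reweighted \<eta> L x"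
    using exists_pmf[OF finite_bitstrings, of "reweighted \<eta> L"] reweighted_nonneg by metis
  have "map_pmf L E1 = map_pmf L D1"
    using E1 by (auto intro!: map_pmf_eqI D1 simp: reweighted_calibrated assms cong: sum.cong)
  moreover have "\<bar>measure_pmf.prob D1 {z. f z} - measure_pmf.prob E1 {z. f z}\<bar> \<le> \<epsilon>"
    if "energy (\<lambda>x. (L x, f x)) < energy L + g" for f
  proof -
    have "\<bar>(\<Sum>x\<in>bitstrings n. pmf D1 x * of_bool (f x)) - (\<Sum>x\<in>bitstrings n. reweighted \<eta> L x * of_bool (f x))\<bar> \<le> \<epsilon>"
      using reweighted_gain[of \<epsilon> f \<eta> L] that assms by argo
    then show ?thesis
      by (simp add: prob_eq_sum_bitstrings D1 E1 cong: sum.cong)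
  qed
  ultimately have "simulates \<epsilon> \<eta> g L D0 E1"
    unfolding simulates_def using E1 D0 reweighted_proportional[of \<eta> L, OF _ assms(2)] assms(1) by simp
  then show thesis by (rule that)
qed

text \<open>\<open>energy_increment\<close> is used with \<open>P\<close> equal to the cost of the
  automaton beyond the \<open>k\<close> label programs; the resulting \<open>s'\<close> then bounds
  the distinguishers and also has room for the test.\<close>

lemma simulation:
  fixes \<epsilon> G \<beta> \<eta> :: real
  assumes "0 < m" "0 < G" "0 < \<epsilon>"
    and sim: "\<And>L. \<exists>E0 E1. simulates \<epsilon> \<eta> (G + 2 / real m ^ 2) L E0 E1 \<and> Q E0 E1"
    and \<beta>: "1 \<le> \<beta>" and \<eta>: "0 < \<eta>" and \<epsilon>: "\<eta> + (\<beta> - 1) \<le> \<epsilon>"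
    and \<tau>: "1 \<le> \<beta> ^ \<tau> * \<eta> ^ k" "\<And>j. j < \<tau> \<Longrightarrow> \<beta> ^ j * \<eta> ^ k \<le> 1"
  obtains s' j E0 E1 where "Q E0 E1" "set_pmf E0 \<subseteq> bitstrings n" "set_pmf E1 \<subseteq> bitstrings n"
    "comp_dist n s' D0 E0 \<le> \<epsilon>" "comp_dist n s' D1 E1 \<le> \<epsilon>"
    "tv_dist (power_pmf k E0) (power_pmf k E1)
       \<le> comp_dist (k * n) s' (power_pmf k D0) (power_pmf k D1) + k * \<epsilon>"
    "s \<le> s'" "real j * G \<le> 1 / 2"
    "s' \<le> (k + 1) ^ j * (s + (2 * k * (\<tau> + 2) * Suc m + (4 * Suc m + 1)))"
proof -
  obtain j t L where L: "real j * G \<le> 1 / 2" "realizable n t (onehot (Suc m) L)" "\<And>z. L z \<le> m"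
    "s + k * t + 2 * k * (\<tau> + 2) * Suc m + (4 * Suc m + 1)
       \<le> (k + 1) ^ j * (s + 2 * k * (\<tau> + 2) * Suc m + (4 * Suc m + 1))"
    "\<And>f. realizable n (s + k * t + 2 * k * (\<tau> + 2) * Suc m) {f} \<Longrightarrow>
       energy (\<lambda>x. (L x, f x)) < energy L + G + 2 / real m ^ 2"
    using energy_increment[OF assms(1,2)] by blast
  define s' where "s' = s + k * t + 2 * k * (\<tau> + 2) * Suc m"
  obtain E0 E1 where E: "simulates \<epsilon> \<eta> (G + 2 / real m ^ 2) L E0 E1" "Q E0 E1"
    using sim by blast
  have circuit: "energy (\<lambda>x. (L x, circuit_value A x)) < energy L + (G + 2 / real m ^ 2)"
    if "wf_circuit n A" "circuit_size A \<le> s'" for A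
  proof -
    have "realizable n s' {circuit_value A}"
      unfolding realizable_iff_circuit using that by blast
    then show ?thesis using L(5) by (simp add: s'_def add.assoc)
  qed
  show thesis
  proof (rule that[OF E(2)])
    show "comp_dist n s' D0 E0 \<le> \<epsilon>" "comp_dist n s' D1 E1 \<le> \<epsilon>"
      using E(1) circuit by (auto intro!: comp_dist_le simp: simulates_def)
    show "set_pmf E0 \<subseteq> bitstrings n" "set_pmf E1 \<subseteq> bitstrings n"
      using E(1) by (auto simp: simulates_def)
    have "tv_dist (power_pmf k E0) (power_pmf k E1)
       \<le> comp_dist (k * n) s' (power_pmf k D0) (power_pmf k D1) + k * (\<eta> + (\<beta> - 1))"
      using E(1) by (intro tv_dist_le_comp_dist[OF L(2,3) _ _ _ _ _ _ \<beta> \<eta> \<tau>])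
        (auto simp: simulates_def s'_def)
    also have "k * (\<eta> + (\<beta> - 1)) \<le> k * \<epsilon>" using \<epsilon> by (intro mult_left_mono) auto
    finally show "tv_dist (power_pmf k E0) (power_pmf k E1)
       \<le> comp_dist (k * n) s' (power_pmf k D0) (power_pmf k D1) + k * \<epsilon>" by simp
    show "s' \<le> (k + 1) ^ j * (s + (2 * k * (\<tau> + 2) * Suc m + (4 * Suc m + 1)))"
      using L(4) by (simp add: s'_def add.assoc)
  qed (use L(1) in \<open>simp_all add: s'_def\<close>)
qed

end

subsection \<open>Size bounds\<close>

text \<open>The slack \<open>4 / 5\<close> pays for \<open>k + 1\<close> in place of \<open>k\<close>, since \<open>(k + 1) ^ 5 \<le> k ^ 8\<close>.\<close>

lemma growth_bound:
  fixes \<delta> :: real and k j :: nat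
  assumes "2 \<le> k" "0 < \<delta>" "real j * (4 / 5 * \<delta>) \<le> 1 / 2"
  shows "real ((k + 1) ^ j) \<le> real k powr (1 / \<delta>)"
proof -
  have k: "real k \<ge> 2" using assms(1) by simp
  \<comment> \<open>For \<open>k \<ge> 2\<close> one has \<open>k + 1 \<le> 3 / 2 * k\<close>, and
    \<open>(3 / 2) ^ 5\<close> is just below \<open>8 \<le> k ^ 3\<close>.\<close>
  have "(real k + 1) ^ 5 \<le> (3 / 2 * real k) ^ 5" using k by (intro power_mono) auto
  also have "\<dots> = 243 / 32 * real k ^ 5" by (simp add: power_mult_distrib power_divide)
  also have "\<dots> \<le> real k ^ 3 * real k ^ 5"
  proof (intro mult_right_mono)
    have "(2::real) ^ 3 \<le> real k ^ 3" using k by (intro power_mono) auto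
    then show "243 / 32 \<le> real k ^ 3" by simp
  qed auto
  finally have 5: "(real k + 1) ^ 5 \<le> real k ^ 8" by (simp flip: power_add)
  have "(real k + 1) powr real j = ((real k + 1) powr 5) powr (real j / 5)"
    by (subst powr_powr) simp
  also have "\<dots> \<le> (real k powr 8) powr (real j / 5)"
    using 5 k by (intro powr_mono2) (auto simp: powr_numeral)
  also have "\<dots> = real k powr (8 * real j / 5)" by (subst powr_powr) simp
  \<comment> \<open>The step budget \<open>real j * (4 / 5 * \<delta>) \<le> 1 / 2\<close> says
    precisely that \<open>8 * j / 5\<close> is at most \<open>1 / \<delta>\<close>.\<close>
  also have "\<dots> \<le> real k powr (1 / \<delta>)"
    using assms k by (intro powr_mono) (auto simp: field_simps)
  finally show ?thesis using k by (simp add: powr_realpow add.commute)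
qed

text \<open>By Bernoulli's inequality about \<open>1 / (\<eta> * c)\<close> factors
  \<open>1 + c\<close> outweigh one factor \<open>\<eta>\<close>, hence a bound linear in
  \<open>k\<close>. The second property is the minimality of \<open>\<tau>\<close>.\<close>

lemma threshold_exists:
  fixes \<eta> c :: real
  assumes "0 < \<eta>" "0 < c"
  obtains \<tau> where "1 \<le> (1 + c) ^ \<tau> * \<eta> ^ k" "\<And>j. j < \<tau> \<Longrightarrow> (1 + c) ^ j * \<eta> ^ k \<le> 1"
    "real \<tau> \<le> real k * (1 / (\<eta> * c) + 1)"
proof -
  define N where "N = nat \<lceil>1 / (\<eta> * c)\<rceil>"
  have N: "1 / (\<eta> * c) \<le> real N" "real N \<le> 1 / (\<eta> * c) + 1"
    using assms by (auto simp: N_def of_nat_ceiling)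
  have "1 \<le> (1 + real N * c) * \<eta>"
    using N(1) assms by (simp add: field_simps)
  also have "\<dots> \<le> (1 + c) ^ N * \<eta>"
    using Bernoulli_inequality[of c N] assms by (intro mult_right_mono) auto
  finally have "1 \<le> ((1 + c) ^ N * \<eta>) ^ k" by (rule one_le_power)
  then have N1: "1 \<le> (1 + c) ^ (N * k) * \<eta> ^ k" by (simp add: power_mult_distrib power_mult)
  define \<tau> where "\<tau> = (LEAST j. 1 \<le> (1 + c) ^ j * \<eta> ^ k)"
  show thesis
  proof (rule that)
    show "1 \<le> (1 + c) ^ \<tau> * \<eta> ^ k" unfolding \<tau>_def
      using LeastI[of "\<lambda>j. 1 \<le> (1 + c) ^ j * \<eta> ^ k" "N * k"] N1 by simp
    show "(1 + c) ^ j * \<eta> ^ k \<le> 1" if "j < \<tau>" for j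
      using not_less_Least[OF that[unfolded \<tau>_def]] by simp
    have "\<tau> \<le> N * k" unfolding \<tau>_def
      using Least_le[of "\<lambda>j. 1 \<le> (1 + c) ^ j * \<eta> ^ k" "N * k"] N1 by simp
    then have "real \<tau> \<le> real k * real N" by (simp add: mult.commute flip: of_nat_mult)
    also have "\<dots> \<le> real k * (1 / (\<eta> * c) + 1)" using N by (intro mult_left_mono) auto
    finally show "real \<tau> \<le> real k * (1 / (\<eta> * c) + 1)" .
  qed
qed

text \<open>In terms of \<open>y = k / \<epsilon>\<^sup>2\<close> the total is at most
  \<open>131 * y\<^sup>2\<close>, hence at most \<open>131 * (k / \<epsilon>) ^ 4\<close>. Since
  \<open>k / \<epsilon>\<close> is at least 4 and \<open>4 ^ 4 = 256\<close>, another fourth power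
  absorbs the constant; this yields the exponent 8.\<close>

lemma overhead_bound:
  fixes \<epsilon> :: real and k m \<tau> :: nat
  assumes k: "2 \<le> k" and \<epsilon>: "0 < \<epsilon>" "\<epsilon> \<le> 1 / 2"
    and m: "real m \<le> 4 / \<epsilon>\<^sup>2 + 1" and \<tau>: "real \<tau> \<le> real k * (1 / (9 / 10 * \<epsilon> * (\<epsilon> / 10)) + 1)"
  shows "real (2 * k * (\<tau> + 2) * Suc m + (4 * Suc m + 1)) \<le> (real k / \<epsilon>) powr 8"
proof -
  define x where "x = 1 / \<epsilon>\<^sup>2"
  define y where "y = real k * x"
  have x: "4 \<le> x"
  proof -
    have "\<epsilon>\<^sup>2 \<le> (1 / 2)\<^sup>2" using \<epsilon> by (intro power_mono) auto
    then show ?thesis using \<epsilon> by (simp add: x_def field_simps power2_eq_square)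
  qed
  have k': "2 \<le> real k" using k by simp
  have xy: "2 * x \<le> y" "real k \<le> y / 4" using x k' mult_mono[of 2 "real k" x x]
    by (simp_all add: y_def)
  have "real (Suc m) \<le> 4 * x + 2" using m by (simp add: x_def)
  also have "\<dots> \<le> 5 * x" using x by simp
  finally have m': "real (Suc m) \<le> 5 * x" .
  have eq: "1 / (9 / 10 * \<epsilon> * (\<epsilon> / 10)) = 100 / 9 * x"
    using \<epsilon> by (simp add: x_def field_simps power2_eq_square)
  have "real \<tau> + 2 \<le> real k * (100 / 9 * x + 1) + 2"
    using \<tau> unfolding eq by linarith
  also have "\<dots> = 100 / 9 * y + real k + 2" by (simp add: y_def algebra_simps)
  also have "\<dots> \<le> 12 * y" using xy k' by linarith
  finally have \<tau>': "real \<tau> + 2 \<le> 12 * y" .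
  have "real k * (real \<tau> + 2) * real (Suc m) \<le> real k * (12 * y) * (5 * x)"
    using m' \<tau>' x xy by (intro mult_mono) auto
  then have "real (2 * k * (\<tau> + 2) * Suc m) \<le> 120 * y\<^sup>2"
    by (simp add: y_def power2_eq_square algebra_simps)
  moreover have "real (4 * Suc m + 1) \<le> 21 * x" using m' x by simp
  moreover have "21 * x \<le> 11 * y" using xy x by simp
  moreover have "11 * y \<le> 11 * y\<^sup>2" using xy x mult_left_mono[of 1 y y] by (simp add: power2_eq_square)
  ultimately have "real (2 * k * (\<tau> + 2) * Suc m + (4 * Suc m + 1)) \<le> 131 * y\<^sup>2"
    unfolding of_nat_add by linarith
  also have "y \<le> (real k / \<epsilon>)\<^sup>2"
    using k' by (simp add: y_def x_def power_divide power2_eq_square divide_right_mono)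
  then have "131 * y\<^sup>2 \<le> 131 * ((real k / \<epsilon>)\<^sup>2)\<^sup>2"
    using xy x by (intro mult_left_mono power_mono) auto
  also have "\<dots> \<le> (real k / \<epsilon>) ^ 4 * (real k / \<epsilon>) ^ 4"
  proof -
    have "4 \<le> real k / \<epsilon>" using k' \<epsilon> by (simp add: field_simps)
    then have "4 ^ 4 \<le> (real k / \<epsilon>) ^ 4" by (intro power_mono) auto
    then have "131 * (real k / \<epsilon>) ^ 4 \<le> (real k / \<epsilon>) ^ 4 * (real k / \<epsilon>) ^ 4"
      by (intro mult_right_mono) auto
    moreover have "((real k / \<epsilon>)\<^sup>2)\<^sup>2 = (real k / \<epsilon>) ^ 4" by (simp flip: power_mult)
    ultimately show ?thesis by simp
  qed
  also have "\<dots> = (real k / \<epsilon>) powr 8"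
    using k' \<epsilon> by (simp add: powr_numeral flip: power_add)
  finally show ?thesis .
qed


text \<open>The choice of \<open>m\<close> limits the merging loss to
  \<open>\<epsilon> ^ 4 / 8\<close>. For \<open>\<epsilon> \<le> 1 / 2\<close> the denominator is at
  most \<open>4 / \<epsilon>\<^sup>2\<close>, with little to spare at \<open>1 / 2\<close>, so the
  reweighted gain is at least \<open>\<epsilon> ^ 4\<close>, and
  \<open>4 / 5 + 1 / 8 < 1\<close>.\<close>

lemma gain_bound:
  fixes \<epsilon> :: real
  assumes "0 < \<epsilon>" "\<epsilon> \<le> 1 / 2" "real m \<ge> 4 / \<epsilon>\<^sup>2"
  shows "4 / 5 * \<epsilon>\<^sup>2 + 2 / real m ^ 2 \<le> 2 * \<epsilon>\<^sup>2"
    and "4 / 5 * \<epsilon> ^ 4 + 2 / real m ^ 2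
      \<le> 4 * \<epsilon>\<^sup>2 / (4 + 3 / (9 / 10 * \<epsilon>) + 1 / (9 / 10 * \<epsilon>)\<^sup>2)"
proof -
  have "(4 / \<epsilon>\<^sup>2)\<^sup>2 \<le> (real m)\<^sup>2" using assms by (intro power_mono) auto
  moreover have "0 < 4 / \<epsilon>\<^sup>2" using assms by simp
  moreover from this have "0 < real m" using assms(3) by linarith
  ultimately have "2 / (real m)\<^sup>2 \<le> 2 / (4 / \<epsilon>\<^sup>2)\<^sup>2"
    by (intro divide_left_mono mult_pos_pos zero_less_power) simp_all
  also have "\<dots> = \<epsilon> ^ 4 / 8" using assms by (simp add: power_divide flip: power_mult)
  finally have m: "2 / (real m)\<^sup>2 \<le> \<epsilon> ^ 4 / 8" .
  have e2: "\<epsilon>\<^sup>2 \<le> 1 / 4" using assms power_mono[of \<epsilon> "1 / 2" 2] by (simp add: power_divide)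
  have e4: "\<epsilon> ^ 4 = \<epsilon>\<^sup>2 * \<epsilon>\<^sup>2" by (simp flip: power_add)
  have "\<epsilon> ^ 4 \<le> \<epsilon>\<^sup>2 * 1" unfolding e4 using e2 by (intro mult_left_mono) auto
  with m show "4 / 5 * \<epsilon>\<^sup>2 + 2 / real m ^ 2 \<le> 2 * \<epsilon>\<^sup>2" using zero_le_power2[of \<epsilon>] by linarith
  define B where "B = 4 + 3 / (9 / 10 * \<epsilon>) + 1 / (9 / 10 * \<epsilon>)\<^sup>2"
  have B0: "0 < B" using assms unfolding B_def by (intro add_pos_pos) auto
  have "3 / (9 / 10 * \<epsilon>) * \<epsilon>\<^sup>2 = 10 / 3 * \<epsilon>" "1 / (9 / 10 * \<epsilon>)\<^sup>2 * \<epsilon>\<^sup>2 = 100 / 81"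
    using assms by (simp_all add: power2_eq_square)
  then have "B * \<epsilon>\<^sup>2 = 4 * \<epsilon>\<^sup>2 + 10 / 3 * \<epsilon> + 100 / 81"
    unfolding B_def by (simp only: distrib_right)
  also have "\<dots> \<le> 4" using e2 assms by simp
  finally have "B * \<epsilon>\<^sup>2 * \<epsilon>\<^sup>2 \<le> 4 * \<epsilon>\<^sup>2" by (intro mult_right_mono) auto
  moreover have "\<epsilon> ^ 4 * B = B * \<epsilon>\<^sup>2 * \<epsilon>\<^sup>2" unfolding e4 by (simp only: ac_simps)
  ultimately have "\<epsilon> ^ 4 \<le> 4 * \<epsilon>\<^sup>2 / B" using B0 by (simp only: pos_le_divide_eq)
  moreover have "0 \<le> \<epsilon> ^ 4" by simp
  ultimately have "4 / 5 * \<epsilon> ^ 4 + 2 / real m ^ 2 \<le> 4 * \<epsilon>\<^sup>2 / B" using m by linarith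
  then show "4 / 5 * \<epsilon> ^ 4 + 2 / real m ^ 2
      \<le> 4 * \<epsilon>\<^sup>2 / (4 + 3 / (9 / 10 * \<epsilon>) + 1 / (9 / 10 * \<epsilon>)\<^sup>2)"
    unfolding B_def .
qed


theorem theorem1p5:
  shows "\<exists>C::real. C > 0 \<and>
    (\<forall>(n::nat) (s::nat) (k::nat) (\<epsilon>::real) (D0::bool list pmf) (D1::bool list pmf).
       2 \<le> k \<longrightarrow> \<epsilon> > 0 \<longrightarrow> set_pmf D0 \<subseteq> bitstrings n \<longrightarrow> set_pmf D1 \<subseteq> bitstrings n \<longrightarrow>
       (\<exists>(s'::nat) (E0::bool list pmf) (E1::bool list pmf).
          set_pmf E0 \<subseteq> bitstrings n \<and> set_pmf E1 \<subseteq> bitstrings n \<and>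
          comp_dist n s' D0 E0 \<le> \<epsilon> \<and> comp_dist n s' D1 E1 \<le> \<epsilon> \<and>
          comp_dist (k * n) s' (power_pmf k D0) (power_pmf k D1) - real k * \<epsilon>
            \<le> tv_dist (power_pmf k E0) (power_pmf k E1) \<and>
          tv_dist (power_pmf k E0) (power_pmf k E1)
            \<le> comp_dist (k * n) s' (power_pmf k D0) (power_pmf k D1) + real k * \<epsilon> \<and>
          s \<le> s' \<and>
          real s' \<le> real k powr (1 / \<epsilon> ^ 2) * (real s + (real k / \<epsilon>) powr C)) \<and>
       (\<exists>(s'::nat) (E0::bool list pmf) (E1::bool list pmf).
          E0 = D0 \<and>
          set_pmf E0 \<subseteq> bitstrings n \<and> set_pmf E1 \<subseteq> bitstrings n \<and>
          comp_dist n s' D0 E0 \<le> \<epsilon> \<and> comp_dist n s' D1 E1 \<le> \<epsilon> \<and>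
          comp_dist (k * n) s' (power_pmf k D0) (power_pmf k D1) - real k * \<epsilon>
            \<le> tv_dist (power_pmf k E0) (power_pmf k E1) \<and>
          tv_dist (power_pmf k E0) (power_pmf k E1)
            \<le> comp_dist (k * n) s' (power_pmf k D0) (power_pmf k D1) + real k * \<epsilon> \<and>
          s \<le> s' \<and>
          real s' \<le> real k powr (1 / \<epsilon> ^ 4) * (real s + (real k / \<epsilon>) powr C)))"
proof (rule exI[of _ 8], intro conjI allI impI)
  fix n s k :: nat and \<epsilon> :: real and D0 D1 :: "bool list pmf"
  assume k: "2 \<le> k" and \<epsilon>: "\<epsilon> > 0"
    and D: "set_pmf D0 \<subseteq> bitstrings n" "set_pmf D1 \<subseteq> bitstrings n"
  interpret bitstring_pair n D0 D1 by standard (fact D)+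
  \<comment> \<open>\<open>1 / \<delta>\<close> is the exponent of \<open>k\<close> and
    \<open>Q\<close> the demand on \<open>E0\<close>, so that one argument yields both
    halves.\<close>
  let ?conclusion = "\<lambda>\<delta> Q. \<exists>s' E0 E1. Q E0 \<and>
          set_pmf E0 \<subseteq> bitstrings n \<and> set_pmf E1 \<subseteq> bitstrings n \<and>
          comp_dist n s' D0 E0 \<le> \<epsilon> \<and> comp_dist n s' D1 E1 \<le> \<epsilon> \<and>
          comp_dist (k * n) s' (power_pmf k D0) (power_pmf k D1) - real k * \<epsilon>
            \<le> tv_dist (power_pmf k E0) (power_pmf k E1) \<and>
          tv_dist (power_pmf k E0) (power_pmf k E1)
            \<le> comp_dist (k * n) s' (power_pmf k D0) (power_pmf k D1) + real k * \<epsilon> \<and>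
          s \<le> s' \<and>
          real s' \<le> real k powr (1 / \<delta>) * (real s + (real k / \<epsilon>) powr 8)"
  have "?conclusion (\<epsilon> ^ 2) (\<lambda>_. True) \<and> ?conclusion (\<epsilon> ^ 4) (\<lambda>E0. E0 = D0)"
  \<comment> \<open>If \<open>k * \<epsilon> \<ge> 1\<close>, both inequalities are void because
    distances lie between 0 and 1. Otherwise \<open>\<epsilon> \<le> 1 / 2\<close>, on which the
    numerical bounds rely.\<close>
  proof (cases "1 \<le> k * \<epsilon>")
    case True
    have "real s \<le> real k powr (1 / \<delta>) * (real s + (real k / \<epsilon>) powr 8)" if "0 < \<delta>" for \<delta> :: real
    proof -
      have "1 \<le> real k powr (1 / \<delta>)" using k that by (intro ge_one_powr_ge_zero) auto
      then have "1 * (real s + 0) \<le> real k powr (1 / \<delta>) * (real s + (real k / \<epsilon>) powr 8)"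
        by (intro mult_mono add_left_mono) auto
      then show ?thesis by simp
    qed
    moreover have "comp_dist (k * n) s (power_pmf k D0) (power_pmf k D1) \<le> 1"
      by (rule order_trans[OF comp_dist_le_tv_dist tv_dist_le_1])
    moreover have "comp_dist n s D0 D0 \<le> \<epsilon>" "comp_dist n s D1 D1 \<le> \<epsilon>"
      using comp_dist_self[of n s] \<epsilon> by (meson less_imp_le order_trans)+
    moreover have "comp_dist (k * n) s (power_pmf k D0) (power_pmf k D1) - k * \<epsilon>
        \<le> tv_dist (power_pmf k D0) (power_pmf k D1)"
      using True calculation(2) tv_dist_nonneg[of "power_pmf k D0" "power_pmf k D1"] by linarith
    moreover have "tv_dist (power_pmf k D0) (power_pmf k D1)
        \<le> comp_dist (k * n) s (power_pmf k D0) (power_pmf k D1) + k * \<epsilon>"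
      using True tv_dist_le_1[of "power_pmf k D0" "power_pmf k D1"]
        comp_dist_nonneg[of "k * n" s "power_pmf k D0" "power_pmf k D1"] by linarith
    ultimately have trivial: "?conclusion \<delta> Q" if "0 < \<delta>" "Q D0" for \<delta> Q
      using that D by (intro exI[of _ s] exI[of _ D0] exI[of _ D1] conjI) simp_all
    show ?thesis
      by (intro conjI trivial) (use \<epsilon> in simp_all)
  next
    case False
    have "2 * \<epsilon> \<le> k * \<epsilon>" using k \<epsilon> by (intro mult_right_mono) auto
    with False have half: "\<epsilon> \<le> 1 / 2" by linarith
    define m where "m = nat \<lceil>4 / \<epsilon>\<^sup>2\<rceil>"
    have m: "4 / \<epsilon>\<^sup>2 \<le> real m" "real m \<le> 4 / \<epsilon>\<^sup>2 + 1" "0 < m"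
      using \<epsilon> by (auto simp: m_def of_nat_ceiling)
    \<comment> \<open>The energy gain for \<open>E0 = D0\<close> forces \<open>\<eta>\<close> to be close to \<open>\<epsilon>\<close>, while \<open>\<eta> + (\<beta> - 1) \<le> \<epsilon>\<close> must hold.\<close>
    let ?\<eta> = "9 / 10 * \<epsilon>" and ?\<beta> = "1 + \<epsilon> / 10"
    obtain \<tau> where \<tau>: "1 \<le> ?\<beta> ^ \<tau> * ?\<eta> ^ k" "\<And>j. j < \<tau> \<Longrightarrow> ?\<beta> ^ j * ?\<eta> ^ k \<le> 1"
      "real \<tau> \<le> real k * (1 / (?\<eta> * (\<epsilon> / 10)) + 1)"
      using threshold_exists[of ?\<eta> "\<epsilon> / 10" k] \<epsilon> by auto
    \<comment> \<open>Interpolation replaces \<open>E0\<close> by some \<open>F0\<close>;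
      \<open>keep\<close> states that the demand \<open>Q\<close> survives this.\<close>
    have main: "?conclusion \<delta> Q" if \<delta>: "0 < \<delta>"
      and keep: "\<And>E0 F0. Q E0 \<Longrightarrow> (E0 = D0 \<longrightarrow> F0 = D0) \<Longrightarrow> Q F0"
      and sim: "\<And>L. \<exists>E0 E1. simulates \<epsilon> ?\<eta> (4 / 5 * \<delta> + 2 / real m ^ 2) L E0 E1 \<and> Q E0" for \<delta> Q
    proof -
      have c: "0 < 4 / 5 * \<delta>" "1 \<le> ?\<beta>" "0 < ?\<eta>" "?\<eta> + (?\<beta> - 1) \<le> \<epsilon>" using \<delta> \<epsilon> by auto
      obtain s' j E0 E1 where E: "Q E0" "set_pmf E0 \<subseteq> bitstrings n" "set_pmf E1 \<subseteq> bitstrings n"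
        "comp_dist n s' D0 E0 \<le> \<epsilon>" "comp_dist n s' D1 E1 \<le> \<epsilon>"
        "tv_dist (power_pmf k E0) (power_pmf k E1)
           \<le> comp_dist (k * n) s' (power_pmf k D0) (power_pmf k D1) + k * \<epsilon>"
        "s \<le> s'" "real j * (4 / 5 * \<delta>) \<le> 1 / 2"
        "s' \<le> (k + 1) ^ j * (s + (2 * k * (\<tau> + 2) * Suc m + (4 * Suc m + 1)))"
        by (rule simulation[where Q = "\<lambda>E0 E1. Q E0" and s = s, OF m(3) c(1) \<epsilon> sim c(2-4) \<tau>(1,2)])
      have "real s' \<le> real ((k + 1) ^ j) * (real s + real (2 * k * (\<tau> + 2) * Suc m + (4 * Suc m + 1)))"
        using E(9) by (simp only: of_nat_le_iff flip: of_nat_add of_nat_mult)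
      also have "\<dots> \<le> real k powr (1 / \<delta>) * (real s + (real k / \<epsilon>) powr 8)"
        using growth_bound[OF k \<delta> E(8)] overhead_bound[OF k \<epsilon> half m(2) \<tau>(3)]
        by (intro mult_mono add_left_mono) auto
      finally have s': "real s' \<le> real k powr (1 / \<delta>) * (real s + (real k / \<epsilon>) powr 8)" .
      have "0 \<le> k * \<epsilon>" using \<epsilon> by simp
      then obtain F0 F1 where
        F: "set_pmf F0 \<subseteq> bitstrings n" "set_pmf F1 \<subseteq> bitstrings n"
          "comp_dist n s' D0 F0 \<le> \<epsilon>" "comp_dist n s' D1 F1 \<le> \<epsilon>"
          "comp_dist (k * n) s' (power_pmf k D0) (power_pmf k D1) - k * \<epsilon>
            \<le> tv_dist (power_pmf k F0) (power_pmf k F1)"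
          "tv_dist (power_pmf k F0) (power_pmf k F1)
            \<le> comp_dist (k * n) s' (power_pmf k D0) (power_pmf k D1) + k * \<epsilon>"
          "E0 = D0 \<longrightarrow> F0 = D0"
        by (rule interpolate[OF D E(2-6)])
      show ?thesis
        by (intro exI[of _ s'] exI[of _ F0] exI[of _ F1] conjI keep[OF E(1) F(7)] F(1-6) E(7) s')
    qed
    note gain = gain_bound[OF \<epsilon> half m(1)]
    have "\<exists>E0 E1. simulates \<epsilon> ?\<eta> (4 / 5 * \<epsilon>\<^sup>2 + 2 / real m ^ 2) L E0 E1 \<and> True" for L
      by (rule simulates_balanced[OF \<epsilon> gain(1)]) blast
    then have "?conclusion (\<epsilon> ^ 2) (\<lambda>_. True)"
      by (rule main[of "\<epsilon> ^ 2" "\<lambda>_. True", rotated 2]) (use \<epsilon> in simp_all)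
    moreover have "0 < ?\<eta>" using \<epsilon> by simp
    then have "\<exists>E0 E1. simulates \<epsilon> ?\<eta> (4 / 5 * \<epsilon> ^ 4 + 2 / real m ^ 2) L E0 E1 \<and> E0 = D0" for L
      by (rule simulates_reweighted[OF \<epsilon> _ gain(2)]) blast
    then have "?conclusion (\<epsilon> ^ 4) (\<lambda>E0. E0 = D0)"
      by (rule main[of "\<epsilon> ^ 4" "\<lambda>E0. E0 = D0", rotated 2]) (use \<epsilon> in simp_all)
    ultimately show ?thesis by (rule conjI)
  qed
  then show "\<exists>s' E0 E1.
          set_pmf E0 \<subseteq> bitstrings n \<and> set_pmf E1 \<subseteq> bitstrings n \<and>
          comp_dist n s' D0 E0 \<le> \<epsilon> \<and> comp_dist n s' D1 E1 \<le> \<epsilon> \<and>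
          comp_dist (k * n) s' (power_pmf k D0) (power_pmf k D1) - real k * \<epsilon>
            \<le> tv_dist (power_pmf k E0) (power_pmf k E1) \<and>
          tv_dist (power_pmf k E0) (power_pmf k E1)
            \<le> comp_dist (k * n) s' (power_pmf k D0) (power_pmf k D1) + real k * \<epsilon> \<and>
          s \<le> s' \<and>
          real s' \<le> real k powr (1 / \<epsilon> ^ 2) * (real s + (real k / \<epsilon>) powr 8)"
    and "\<exists>s' E0 E1. E0 = D0 \<and>
          set_pmf E0 \<subseteq> bitstrings n \<and> set_pmf E1 \<subseteq> bitstrings n \<and>
          comp_dist n s' D0 E0 \<le> \<epsilon> \<and> comp_dist n s' D1 E1 \<le> \<epsilon> \<and>
          comp_dist (k * n) s' (power_pmf k D0) (power_pmf k D1) - real k * \<epsilon>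
            \<le> tv_dist (power_pmf k E0) (power_pmf k E1) \<and>
          tv_dist (power_pmf k E0) (power_pmf k E1)
            \<le> comp_dist (k * n) s' (power_pmf k D0) (power_pmf k D1) + real k * \<epsilon> \<and>
          s \<le> s' \<and>
          real s' \<le> real k powr (1 / \<epsilon> ^ 4) * (real s + (real k / \<epsilon>) powr 8)"
    by (simp_all only: simp_thms)
qed simp

end
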